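(* Let $0<\alpha<1$, $c_1>0$ and $c_2>0$. The Markov process on $[0,1]$ associated with the operator $A_\alpha$ has a unique stationary distribution, and this stationary distribution coincides with $$P_{\alpha,(c_1,c_2)}(dx)=\Gamma(\alpha+1)\int_0^1 B_{c_1,c_2}(dy)\,E_{\alpha,y}\left[(Y_1+Y_2)^{-\alpha};\ \frac{Y_1}{Y_1+Y_2}\in dx\right].$$
   Context: For $a,b>0$, $B_{a,b}$ denotes the beta distribution on $[0,1]$, $B_{a,b}(dx)=\frac{\Gamma(a+b)}{\Gamma(a)\Gamma(b)}x^{a-1}(1-x)^{b-1}\,dx$. For $0<\alpha<1$ and $c_1,c_2>0$, the operator $A_\alpha$ acts on smooth functions $G$ on $[0,1]$ by $$A_{\alpha}G(x)=\int_0^1\frac{B_{1-\alpha,1+\alpha}(du)}{u^2}\bigl[xG((1-u)x+u)+(1-x)G((1-u)x)-G(x)\bigr]$$ $$\qquad+\int_0^1\frac{B_{1-\alpha,\alpha}(du)}{(\alpha+1)u}\bigl[c_1G((1-u)x+u)+c_2G((1-u)x)-(c_1+c_2)G(x)\bigr].$$ The closure of $A_\alpha$ (defined on polynomials) generates a Feller semigroup on $C([0,1])$; the process associated with $A_\alpha$ is the corresponding Markov process on $[0,1]$. A stationary distribution is a Borel probability measure on $[0,1]$ invariant under this semigroup. For $y\in(0,1)$, $E_{\alpha,y}$ denotes the expectation with respect to a pair $(Y_1,Y_2)$ of nonnegative random variables whose joint law is determined by $E_{\alpha,y}[e^{-\lambda_1Y_1-\lambda_2Y_2}]=e^{-y\lambda_1^{\alpha}-(1-y)\lambda_2^{\alpha}}$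 for $\lambda_1,\lambda_2\ge0$. The notation $E[X;\mathcal{E}]$ means $E[X\mathbf{1}_{\mathcal{E}}]$. One has $E_{\alpha,y}[(Y_1+Y_2)^{-\alpha}]=1/\Gamma(\alpha+1)$, so $P_{\alpha,(c_1,c_2)}$ is a probability measure on $[0,1]$. *)

theory Defs
  imports "HOL-Probability.Probability"
begin

definition beta_distribution :: "real \<Rightarrow> real \<Rightarrow> real measure" where
  "beta_distribution a b = density lborel (\<lambda>x. ennreal (indicator {0..1} x *
     (Gamma (a + b) / (Gamma a * Gamma b)) * x powr (a - 1) * (1 - x) powr (b - 1)))"

definition A_op :: "real \<Rightarrow> real \<Rightarrow> real \<Rightarrow> (real \<Rightarrow> real) \<Rightarrow> real \<Rightarrow> real" where
  "A_op \<alpha> c1 c2 G x =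
     (\<integral>u. (x * G ((1 - u) * x + u) + (1 - x) * G ((1 - u) * x) - G x) / u\<^sup>2
        \<partial>beta_distribution (1 - \<alpha>) (1 + \<alpha>))
   + (\<integral>u. (c1 * G ((1 - u) * x + u) + c2 * G ((1 - u) * x) - (c1 + c2) * G x) / ((\<alpha> + 1) * u)
        \<partial>beta_distribution (1 - \<alpha>) \<alpha>)"

text \<open>
  Elements of \<open>C([0,1])\<close> are represented by functions on the reals that are continuous on
  \<open>{0..1}\<close>; their values off \<open>{0..1}\<close> are irrelevant.  Operators on \<open>C([0,1])\<close> are
  identified with their graphs, as sets of pairs of such representatives.
\<close>

definition C01 :: "(real \<Rightarrow> real) set" where
  "C01 = {f. continuous_on {0..1} f}"

text \<open>
  A Feller semigroup on the compact space \<open>[0,1]\<close>.  Contractivity in the supremum norm, and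
  the fact that the values of \<open>T t f\<close> on \<open>[0,1]\<close> depend only on those of \<open>f\<close> there,
  follow from linearity, positivity and \<open>T t 1 = 1\<close>.
\<close>

definition feller_semigroup :: "(real \<Rightarrow> (real \<Rightarrow> real) \<Rightarrow> real \<Rightarrow> real) \<Rightarrow> bool" where
  "feller_semigroup T \<longleftrightarrow>
     (\<forall>t\<ge>0. \<forall>f\<in>C01. T t f \<in> C01) \<and>
     (\<forall>t\<ge>0. \<forall>f\<in>C01. \<forall>g\<in>C01. \<forall>a b. \<forall>x\<in>{0..1}.
        T t (\<lambda>z. a * f z + b * g z) x = a * T t f x + b * T t g x) \<and>
     (\<forall>t\<ge>0. \<forall>f\<in>C01. (\<forall>x\<in>{0..1}. 0 \<le> f x) \<longrightarrow> (\<forall>x\<in>{0..1}. 0 \<le> T t f x)) \<and>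
     (\<forall>t\<ge>0. \<forall>x\<in>{0..1}. T t (\<lambda>_. 1) x = 1) \<and>
     (\<forall>f\<in>C01. \<forall>x\<in>{0..1}. T 0 f x = f x) \<and>
     (\<forall>s\<ge>0. \<forall>t\<ge>0. \<forall>f\<in>C01. \<forall>x\<in>{0..1}. T (s + t) f x = T s (T t f) x) \<and>
     (\<forall>f\<in>C01. uniform_limit {0..1} (\<lambda>t. T t f) f (at_right 0))"

definition generator ::
    "(real \<Rightarrow> (real \<Rightarrow> real) \<Rightarrow> real \<Rightarrow> real) \<Rightarrow> ((real \<Rightarrow> real) \<times> (real \<Rightarrow> real)) set" where
  "generator T = {(f, g). f \<in> C01 \<and> g \<in> C01 \<and>
     uniform_limit {0..1} (\<lambda>t x. (T t f x - f x) / t) g (at_right 0)}"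

definition graph_closure ::
    "((real \<Rightarrow> real) \<times> (real \<Rightarrow> real)) set \<Rightarrow> ((real \<Rightarrow> real) \<times> (real \<Rightarrow> real)) set" where
  "graph_closure R = {(f, g). f \<in> C01 \<and> g \<in> C01 \<and>
     (\<exists>F H. (\<forall>n::nat. (F n, H n) \<in> R) \<and>
        uniform_limit {0..1} F f sequentially \<and> uniform_limit {0..1} H g sequentially)}"

definition A_poly_graph :: "real \<Rightarrow> real \<Rightarrow> real \<Rightarrow> ((real \<Rightarrow> real) \<times> (real \<Rightarrow> real)) set" where
  "A_poly_graph \<alpha> c1 c2 = {(poly p, A_op \<alpha> c1 c2 (poly p)) | p. True}"

definition stationary_distribution ::
    "(real \<Rightarrow> (real \<Rightarrow> real) \<Rightarrow> real \<Rightarrow> real) \<Rightarrow> real measure \<Rightarrow> bool" where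
  "stationary_distribution T \<mu> \<longleftrightarrow>
     prob_space \<mu> \<and> sets \<mu> = sets (restrict_space borel {0..1}) \<and>
     (\<forall>t\<ge>0. \<forall>f\<in>C01. (\<integral>x. T t f x \<partial>\<mu>) = (\<integral>x. f x \<partial>\<mu>))"

text \<open>\<open>M\<close> is the joint law of the pair \<open>(Y\<^sub>1, Y\<^sub>2)\<close> underlying the expectation
  \<open>E\<close> with parameters \<open>\<alpha>\<close> and \<open>y\<close>.\<close>

definition stable_pair_law :: "real \<Rightarrow> real \<Rightarrow> (real \<times> real) measure \<Rightarrow> bool" where
  "stable_pair_law \<alpha> y M \<longleftrightarrow>
     prob_space M \<and> sets M = sets borel \<and>
     (AE (Y1, Y2) in M. 0 \<le> Y1 \<and> 0 \<le> Y2) \<and>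
     (\<forall>l1\<ge>0. \<forall>l2\<ge>0. (\<integral>(Y1, Y2). exp (- l1 * Y1 - l2 * Y2) \<partial>M)
        = exp (- y * l1 powr \<alpha> - (1 - y) * l2 powr \<alpha>))"

text \<open>
  \<open>Q y\<close> is the joint law of \<open>(Y\<^sub>1, Y\<^sub>2)\<close> for the parameter \<open>y\<close>.  Only \<open>y\<close> in
  \<open>(0,1)\<close> matters, the complement being null for the beta distribution, and the conventions
  \<open>0 powr (-\<alpha>) = 0\<close> and \<open>0 / 0 = 0\<close> are harmless since \<open>Y\<^sub>1 + Y\<^sub>2 > 0\<close> almost surely.
\<close>

definition P_measure ::
    "real \<Rightarrow> real \<Rightarrow> real \<Rightarrow> (real \<Rightarrow> (real \<times> real) measure) \<Rightarrow> real measure" where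
  "P_measure \<alpha> c1 c2 Q = measure_of {0..1} (sets (restrict_space borel {0..1}))
     (\<lambda>S. ennreal (Gamma (\<alpha> + 1)) *
        (\<integral>\<^sup>+y. (\<integral>\<^sup>+(Y1, Y2). ennreal ((Y1 + Y2) powr (- \<alpha>)) * indicator S (Y1 / (Y1 + Y2)) \<partial>Q y)
           \<partial>beta_distribution c1 c2))"

end

theory Submission
  imports Defs
begin

text \<open>
  Everything is reduced to the moments \<open>m\<^sub>n = \<integral> x\<^sup>n \<mu>(dx)\<close>, collected in the transform
  \<open>F\<^sub>\<mu>(z) = \<integral> (1 + z x)\<^sup>-\<^sup>\<alpha> \<mu>(dx)\<close>, a power series whose coefficients are the moments times
  nonzero binomial coefficients (\<open>moment_series\<close>).

  Stationarity. Since the generator is the closure of the operator on polynomials, a law on \<open>[0,1]\<close> is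
  invariant if and only if it annihilates the image of every power \<open>x\<^sup>n\<close>
  (\<open>stationary_imp_generator_null\<close>, \<open>generator_null_imp_stationary\<close>). These images are explicit polynomials,
  obtained from beta integrals, and the conditions for all \<open>n\<close> together say that the
  first-order differential equation
  \<open>((1+z)\<^sup>\<alpha> - 1) (1+z) F'(z) + \<alpha> (c\<^sub>2 - 1 + c\<^sub>1 (1+z)\<^sup>\<alpha>) F(z) = const\<close>
  holds for \<open>F = F\<^sub>\<mu>\<close> (\<open>A_op_power_moment_ode\<close>, \<open>stationary_iff_moment_ode\<close>).

  Uniqueness. Read coefficientwise, the equation determines each moment from the lower ones, and
  moments determine a law on \<open>[0,1]\<close> (\<open>stationary_unique\<close>).

  Existence. Writing \<open>w\<^sup>-\<^sup>\<alpha>\<close> as a Gamma integral, the Laplace transform of the stable pair gives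
  \<open>\<Gamma>(\<alpha>+1) E[((1+z) Y\<^sub>1 + Y\<^sub>2)\<^sup>-\<^sup>\<alpha>] = 1 / (1 - y (1 - (1+z)\<^sup>\<alpha>))\<close>, and the left-hand side is the
  transform of the weighted law of \<open>Y\<^sub>1 / (Y\<^sub>1 + Y\<^sub>2)\<close> (\<open>ratio_law_moment_series\<close>). Integrating over the beta
  law of \<open>y\<close> shows that the transform of \<open>P_measure\<close> is the hypergeometric series
  \<open>\<^sub>2F\<^sub>1(1, c\<^sub>1; c\<^sub>1 + c\<^sub>2; x)\<close> at \<open>x = 1 - (1+z)\<^sup>\<alpha>\<close> (\<open>P_measure_moment_series\<close>), and the
  hypergeometric equation becomes the differential equation above under this substitution
  (\<open>moment_ode_compose_beta\<close>). Along the way the explicit moments, which are polynomials in \<open>y\<close>, show that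
  the family of laws of the ratio is a measurable kernel, so that \<open>P_measure\<close> is a genuine
  mixture (\<open>P_measure_eq_bind\<close>).
\<close>

section \<open>Laws on the unit interval and their moments\<close>

abbreviation unit_borel :: "real measure" where "unit_borel \<equiv> restrict_space borel {0..1}"

definition unit_law :: "real measure \<Rightarrow> bool" where
  "unit_law \<mu> \<longleftrightarrow> prob_space \<mu> \<and> sets \<mu> = sets unit_borel"

lemma unit_law_space: "unit_law \<mu> \<Longrightarrow> space \<mu> = {0..1}"
  unfolding unit_law_def using sets_eq_imp_space_eq[of \<mu> "restrict_space borel {0..1}"]
  by (simp add: space_restrict_space)

lemma C01_bounded: assumes "f \<in> C01" obtains B where "B > 0" "\<And>x. x \<in> {0..1} \<Longrightarrow> \<bar>f x\<bar> \<le> B"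
proof -
  have "compact (f ` {0..1})"
    using assms unfolding C01_def by (intro compact_continuous_image) auto
  hence "bounded (f ` {0..1})" by (rule compact_imp_bounded)
  then obtain B where "B > 0" "\<forall>y\<in>f ` {0..1}. norm y \<le> B" unfolding bounded_pos by blast
  then show ?thesis by (intro that[of B]) auto
qed

lemma C01_integrable: assumes "unit_law \<mu>" "f \<in> C01" shows "integrable \<mu> f"
proof -
  interpret prob_space \<mu> using assms unfolding unit_law_def by blast
  obtain B where B: "\<And>x. x \<in> {0..1} \<Longrightarrow> \<bar>f x\<bar> \<le> B" using C01_bounded[OF assms(2)] by metis
  have "f \<in> borel_measurable (restrict_space borel {0..1})"
    using assms(2) unfolding C01_def by (intro borel_measurable_continuous_on_restrict) auto
  hence m: "f \<in> borel_measurable \<mu>"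
    using assms(1) unfolding unit_law_def by (metis measurable_cong_sets)
  show ?thesis
    by (rule integrable_const_bound[of _ B])
       (use m B unit_law_space[OF assms(1)] in auto)
qed

lemma C01_integral_bound:
  assumes "unit_law \<mu>" "f \<in> C01" "\<And>x. x \<in> {0..1} \<Longrightarrow> \<bar>f x\<bar> \<le> e"
  shows "\<bar>\<integral>x. f x \<partial>\<mu>\<bar> \<le> e"
proof -
  interpret prob_space \<mu> using assms unfolding unit_law_def by blast
  note i = C01_integrable[OF assms(1,2)]
  note s = unit_law_space[OF assms(1)]
  have "(\<integral>x. f x \<partial>\<mu>) \<le> e" 
    using assms(3) s by (intro integral_le_const i AE_I2) (auto simp: abs_le_iff)
  moreover have "- e \<le> (\<integral>x. f x \<partial>\<mu>)" 
    using assms(3) s by (intro integral_ge_const i AE_I2) (force simp: abs_le_iff)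
  ultimately show ?thesis by simp
qed

lemma C01_const: "(\<lambda>_. c) \<in> C01" by (simp add: C01_def)

lemma C01_lincomb: "f \<in> C01 \<Longrightarrow> g \<in> C01 \<Longrightarrow> (\<lambda>z. a * f z + b * g z) \<in> C01"
  by (auto simp: C01_def intro!: continuous_intros)

lemma integral_C01_lincomb:
  assumes "unit_law \<mu>" "f \<in> C01" "g \<in> C01"
  shows "(\<integral>x. a * f x + b * g x \<partial>\<mu>) = a * (\<integral>x. f x \<partial>\<mu>) + b * (\<integral>x. g x \<partial>\<mu>)"
  using C01_integrable[OF assms(1)] assms(2,3) by simp

lemma C01_integral_cong:
  assumes "unit_law \<mu>" "\<And>x. x \<in> {0..1} \<Longrightarrow> f x = g x"
  shows "(\<integral>x. f x \<partial>\<mu>) = (\<integral>x. g x \<partial>\<mu>)"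
  using assms unit_law_space[OF assms(1)] by (intro Bochner_Integration.integral_cong) auto

lemma C01_integral_uniform_limit:
  fixes F :: "nat \<Rightarrow> real \<Rightarrow> real"
  assumes "unit_law \<mu>" "\<And>n. F n \<in> C01" "f \<in> C01" "uniform_limit {0..1} F f sequentially"
  shows "(\<lambda>n. \<integral>x. F n x \<partial>\<mu>) \<longlonglongrightarrow> (\<integral>x. f x \<partial>\<mu>)"
proof (rule LIMSEQ_I)
  fix r :: real assume r: "r > 0"
  have "\<forall>\<^sub>F n in sequentially. \<forall>x\<in>{0..1}. dist (F n x) (f x) < r/2"
    using assms(4)[unfolded uniform_limit_iff, rule_format, of "r/2"] r by simp
  then obtain N where N: "\<And>n x. n \<ge> N \<Longrightarrow> x \<in> {0..1} \<Longrightarrow> \<bar>F n x - f x\<bar> < r/2"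
    unfolding eventually_sequentially dist_real_def by blast
  have "\<bar>(\<integral>x. F n x \<partial>\<mu>) - (\<integral>x. f x \<partial>\<mu>)\<bar> < r" if "n \<ge> N" for n
  proof -
    have "\<bar>\<integral>x. 1 * F n x + (-1) * f x \<partial>\<mu>\<bar> \<le> r/2"
      using N[OF that] assms by (intro C01_integral_bound C01_lincomb) (auto intro: less_imp_le)
    then show ?thesis unfolding integral_C01_lincomb[OF assms(1,2,3)] using r by simp
  qed
  then show "\<exists>no. \<forall>n\<ge>no. norm ((\<integral>x. F n x \<partial>\<mu>) - (\<integral>x. f x \<partial>\<mu>)) < r" by auto
qed

lemma C01_poly: "poly p \<in> C01"
  by (simp add: C01_def continuous_on_poly)

text \<open>
  The Weierstrass theorem in the form used below to pass from moments to continuous functions.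
\<close>
lemma C01_poly_approx:
  assumes "f \<in> C01" obtains p :: "nat \<Rightarrow> real poly" where "uniform_limit {0..1} (\<lambda>n. poly (p n)) f sequentially"
proof -
  have "\<exists>q. \<forall>x\<in>{0..1}. \<bar>f x - poly q x\<bar> < 1 / Suc n" for n
  proof -
    obtain g where g: "real_polynomial_function g" "\<And>x. x \<in> {0..1} \<Longrightarrow> \<bar>f x - g x\<bar> < 1 / Suc n"
      by (rule Stone_Weierstrass_real_polynomial_function[of "{0..1}" f "1 / Suc n"])
        (use assms in \<open>auto simp: C01_def\<close>)
    from g(1) obtain a n' where "g = (\<lambda>x. \<Sum>i\<le>n'. a i * x ^ i)"
      unfolding real_polynomial_function_iff_sum by blast
    hence "g = poly (\<Sum>i\<le>n'. monom (a i) i)" by (auto simp: poly_sum poly_monom)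
    then show ?thesis using g(2) by (intro exI[of _ "\<Sum>i\<le>n'. monom (a i) i"]) auto
  qed
  then obtain p where p: "\<And>n x. x \<in> {0..1} \<Longrightarrow> \<bar>f x - poly (p n) x\<bar> < 1 / Suc n" by metis
  have "uniform_limit {0..1} (\<lambda>n. poly (p n)) f sequentially"
    unfolding uniform_limit_iff
  proof safe
    fix e :: real assume "e > 0"
    then obtain N where N: "1 / Suc N < e" using nat_approx_posE by metis
    have "dist (poly (p n) x) (f x) < e" if "n \<ge> N" "x \<in> {0..1}" for n x
    proof -
      have "\<bar>f x - poly (p n) x\<bar> < 1 / Suc n" using p that by blast
      also have "1 / Suc n \<le> 1 / Suc N" using that by (simp add: frac_le)
      finally show ?thesis using N by (simp add: dist_real_def abs_minus_commute)
    qed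
    then show "\<forall>\<^sub>F n in sequentially. \<forall>x\<in>{0..1}. dist (poly (p n) x) (f x) < e"
      unfolding eventually_sequentially by blast
  qed
  then show ?thesis by (rule that)
qed

lemma integral_poly_moments:
  assumes "unit_law \<mu>"
  shows "(\<integral>x. poly p x \<partial>\<mu>) = (\<Sum>n\<le>degree p. coeff p n * (\<integral>x. x ^ n \<partial>\<mu>))"
proof -
  have "integrable \<mu> (\<lambda>x. x ^ n)" for n
    by (rule C01_integrable[OF assms]) (auto simp: C01_def intro!: continuous_intros)
  then show ?thesis by (simp add: poly_altdef)
qed

text \<open>
  By the Weierstrass theorem equal moments give equal integrals of continuous functions, in particular of
  \<open>cos (t x)\<close> and \<open>sin (t x)\<close>; hence the characteristic functions agree.
\<close>
lemma unit_law_eq_if_moments_eq: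
  assumes "unit_law \<mu>" "unit_law \<nu>" "\<And>n. (\<integral>x. x ^ n \<partial>\<mu>) = (\<integral>x. x ^ n \<partial>\<nu>)"
  shows "\<mu> = \<nu>"
proof -
  have C: "(\<integral>x. f x \<partial>\<mu>) = (\<integral>x. f x \<partial>\<nu>)" if f: "f \<in> C01" for f
  proof -
    obtain p where p: "uniform_limit {0..1} (\<lambda>n. poly (p n)) f sequentially"
      using C01_poly_approx[OF f] .
    have "(\<integral>x. poly (p n) x \<partial>\<mu>) = (\<integral>x. poly (p n) x \<partial>\<nu>)" for n
      by (simp add: integral_poly_moments assms)
    moreover note C01_integral_uniform_limit[OF assms(1) C01_poly f p]
      C01_integral_uniform_limit[OF assms(2) C01_poly f p]
    ultimately show ?thesis using LIMSEQ_unique by auto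
  qed
  have idm: "(\<lambda>x::real. x) \<in> borel_measurable \<kappa>" if "unit_law \<kappa>" for \<kappa>
  proof -
    have "(\<lambda>x::real. x) \<in> borel_measurable (restrict_space borel {0..1})"
      by (intro borel_measurable_continuous_on_restrict continuous_intros)
    then show ?thesis using that unfolding unit_law_def by (metis measurable_cong_sets)
  qed
  have rd: "real_distribution (distr \<kappa> borel (\<lambda>x. x))" if "unit_law \<kappa>" for \<kappa>
    using idm[OF that] that prob_space.real_distribution_distr unfolding unit_law_def by blast
  have ch: "char (distr \<kappa> borel (\<lambda>x. x)) t = Complex (\<integral>x. cos (t * x) \<partial>\<kappa>) (\<integral>x. sin (t * x) \<partial>\<kappa>)"
    if "unit_law \<kappa>" for \<kappa> t
  proof -
    have i1: "integrable \<kappa> (\<lambda>x. cos (t * x))" and i2: "integrable \<kappa> (\<lambda>x. sin (t * x))"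
      by (rule C01_integrable[OF that], auto simp: C01_def intro!: continuous_intros)+
    have "char (distr \<kappa> borel (\<lambda>x. x)) t = (\<integral>x. iexp (t * x) \<partial>\<kappa>)"
      unfolding char_def using idm[OF that] by (subst integral_distr) auto
    also have "\<dots> = (\<integral>x. complex_of_real (cos (t * x)) + \<i> * complex_of_real (sin (t * x)) \<partial>\<kappa>)"
      by (simp only: cis_conv_exp[symmetric] cis.code Complex_eq)
    also have "\<dots> = complex_of_real (\<integral>x. cos (t * x) \<partial>\<kappa>) + \<i> * complex_of_real (\<integral>x. sin (t * x) \<partial>\<kappa>)"
      using i1 i2 by (subst Bochner_Integration.integral_add) (auto simp: integral_complex_of_real)
    finally show ?thesis by (simp add: Complex_eq)
  qed
  have "char (distr \<mu> borel (\<lambda>x. x)) = char (distr \<nu> borel (\<lambda>x. x))"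
  proof
    fix t
    have "(\<integral>x. cos (t * x) \<partial>\<mu>) = (\<integral>x. cos (t * x) \<partial>\<nu>)"
         "(\<integral>x. sin (t * x) \<partial>\<mu>) = (\<integral>x. sin (t * x) \<partial>\<nu>)"
      by (rule C, auto simp: C01_def intro!: continuous_intros)+
    then show "char (distr \<mu> borel (\<lambda>x. x)) t = char (distr \<nu> borel (\<lambda>x. x)) t"
      by (simp add: ch assms)
  qed
  hence eq: "distr \<mu> borel (\<lambda>x. x) = distr \<nu> borel (\<lambda>x. x)"
    using Levy_uniqueness rd assms by blast
  show ?thesis
  proof (rule measure_eqI)
    show "sets \<mu> = sets \<nu>" using assms unfolding unit_law_def by simp
    fix A assume "A \<in> sets \<mu>"
    hence A: "A \<in> sets (restrict_space borel {0..1::real})" using assms unfolding unit_law_def by simp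
    hence A': "A \<in> sets borel" "A \<subseteq> {0..1}"
      by (auto simp: sets_restrict_space)
    have "emeasure \<kappa> A = emeasure (distr \<kappa> borel (\<lambda>x. x)) A" if "unit_law \<kappa>" for \<kappa>
      using A' that unit_law_space[OF that] by (subst emeasure_distr) (auto simp: idm Int_absorb2)
    then show "emeasure \<mu> A = emeasure \<nu> A" using eq assms by metis
  qed
qed

section \<open>Feller semigroups: stationary laws annihilate the generator\<close>

lemma feller_C01: "feller_semigroup T \<Longrightarrow> t \<ge> 0 \<Longrightarrow> f \<in> C01 \<Longrightarrow> T t f \<in> C01"
  unfolding feller_semigroup_def by (drule conjunct1) blast

lemma feller_lincomb:
  assumes "feller_semigroup T" "t \<ge> 0" "f \<in> C01" "g \<in> C01" "x \<in> {0..1}"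
  shows "T t (\<lambda>z. a * f z + b * g z) x = a * T t f x + b * T t g x"
proof -
  have "\<forall>t\<ge>0. \<forall>f\<in>C01. \<forall>g\<in>C01. \<forall>a b. \<forall>x\<in>{0..1}.
        T t (\<lambda>z. a * f z + b * g z) x = a * T t f x + b * T t g x"
    using assms(1) unfolding feller_semigroup_def by (elim conjE)
  from this[rule_format, OF assms(2-5)] show ?thesis .
qed

lemma feller_nonneg:
  assumes "feller_semigroup T" "t \<ge> 0" "f \<in> C01" "\<And>x. x \<in> {0..1} \<Longrightarrow> 0 \<le> f x" "x \<in> {0..1}"
  shows "0 \<le> T t f x"
proof -
  have "\<forall>t\<ge>0. \<forall>f\<in>C01. (\<forall>x\<in>{0..1}. 0 \<le> f x) \<longrightarrow> (\<forall>x\<in>{0..1}. 0 \<le> T t f x)"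
    using assms(1) unfolding feller_semigroup_def by (elim conjE)
  from this[rule_format, OF assms(2-4) assms(5)] show ?thesis by simp
qed

lemma feller_one:
  assumes "feller_semigroup T" "t \<ge> 0" "x \<in> {0..1}"
  shows "T t (\<lambda>_. 1) x = 1"
proof -
  have "\<forall>t\<ge>0. \<forall>x\<in>{0..1}. T t (\<lambda>_. 1) x = 1"
    using assms(1) unfolding feller_semigroup_def by (elim conjE)
  from this[rule_format, OF assms(2,3)] show ?thesis .
qed

lemma feller_zero:
  assumes "feller_semigroup T" "f \<in> C01" "x \<in> {0..1}"
  shows "T 0 f x = f x"
proof -
  have "\<forall>f\<in>C01. \<forall>x\<in>{0..1}. T 0 f x = f x"
    using assms(1) unfolding feller_semigroup_def by (elim conjE)
  from this[rule_format, OF assms(2,3)] show ?thesis .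
qed

lemma feller_add:
  assumes "feller_semigroup T" "s \<ge> 0" "t \<ge> 0" "f \<in> C01" "x \<in> {0..1}"
  shows "T (s + t) f x = T s (T t f) x"
proof -
  have "\<forall>s\<ge>0. \<forall>t\<ge>0. \<forall>f\<in>C01. \<forall>x\<in>{0..1}. T (s + t) f x = T s (T t f) x"
    using assms(1) unfolding feller_semigroup_def by (elim conjE)
  from this[rule_format, OF assms(2-5)] show ?thesis .
qed

text \<open>
  Positivity applied to \<open>B + f\<close> and \<open>B - f\<close>, both nonnegative.
\<close>
lemma feller_contraction:
  assumes fs: "feller_semigroup T" and t: "t \<ge> 0" and f: "f \<in> C01"
    and B: "\<And>x. x \<in> {0..1} \<Longrightarrow> \<bar>f x\<bar> \<le> B" and x: "x \<in> {0..1}"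
  shows "\<bar>T t f x\<bar> \<le> B"
proof -
  have lin: "T t (\<lambda>z. a * g z + b * h z) x = a * T t g x + b * T t h x" if "g \<in> C01" "h \<in> C01" for a b g h
    by (rule feller_lincomb[OF fs t that x])
  have one: "T t (\<lambda>_. 1) x = 1" by (rule feller_one[OF fs t x])
  have pos: "0 \<le> T t g x" if "g \<in> C01" "\<And>x. x \<in> {0..1} \<Longrightarrow> 0 \<le> g x" for g
    by (rule feller_nonneg[OF fs t that x])
  have "0 \<le> T t (\<lambda>z. B * (\<lambda>_. 1) z + b * f z) x" if "b = 1 \<or> b = -1" for b
  proof (intro pos C01_lincomb C01_const f)
    fix z :: real assume "z \<in> {0..1}"
    from B[OF this] that show "0 \<le> B * 1 + b * f z" by auto
  qed
  hence "0 \<le> B + b * T t f x" if "b = 1 \<or> b = -1" for b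
    using that lin[OF C01_const[of 1] f] one by simp
  from this[of 1] this[of "-1"] show ?thesis by auto
qed

text \<open>
  All difference quotients \<open>(T t f - f) / t\<close> have mean zero, hence so has their uniform limit \<open>g\<close>.
\<close>
lemma stationary_imp_generator_null:
  assumes fs: "feller_semigroup T" and st: "stationary_distribution T \<mu>" and fg: "(f, g) \<in> generator T"
  shows "(\<integral>x. g x \<partial>\<mu>) = 0"
proof -
  have ul: "unit_law \<mu>" using st unfolding stationary_distribution_def unit_law_def by blast
  have f: "f \<in> C01" and g: "g \<in> C01" and
    ulim: "uniform_limit {0..1} (\<lambda>t x. (T t f x - f x) / t) g (at_right 0)"
    using fg unfolding generator_def by auto
  have "\<bar>\<integral>x. g x \<partial>\<mu>\<bar> \<le> e" if e: "e > 0" for e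
  proof -
    have "\<forall>\<^sub>F t in at_right 0. \<forall>x\<in>{0..1}. dist ((T t f x - f x) / t) (g x) < e"
      using ulim[unfolded uniform_limit_iff, rule_format, OF e] .
    moreover have "\<forall>\<^sub>F t in at_right (0::real). t > 0" by (rule eventually_at_right_less)
    ultimately have "\<forall>\<^sub>F t in at_right 0. t > 0 \<and> (\<forall>x\<in>{0..1}. dist ((T t f x - f x) / t) (g x) < e)"
      by eventually_elim auto
    then obtain t where t: "t > 0" and d: "\<And>x. x\<in>{0..1} \<Longrightarrow> dist ((T t f x - f x) / t) (g x) < e"
      using eventually_happens[OF _ ] trivial_limit_at_right_real by (metis (mono_tags, lifting))
    have Tf: "T t f \<in> C01" using t by (intro feller_C01[OF fs _ f]) simp
    have 1: "(\<lambda>z. (1/t) * T t f z + (-1/t) * f z) \<in> C01" by (rule C01_lincomb[OF Tf f])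
    have z: "(\<integral>x. (1/t) * T t f x + (-1/t) * f x \<partial>\<mu>) = 0"
      using st t f unfolding integral_C01_lincomb[OF ul Tf f] stationary_distribution_def by simp
    have "\<bar>\<integral>x. 1 * g x + (-1) * ((1/t) * T t f x + (-1/t) * f x) \<partial>\<mu>\<bar> \<le> e"
    proof (rule C01_integral_bound[OF ul C01_lincomb[OF g 1]])
      fix x :: real assume "x \<in> {0..1}"
      from d[OF this] show "\<bar>1 * g x + (-1) * ((1/t) * T t f x + (-1/t) * f x)\<bar> \<le> e"
        by (simp add: dist_real_def diff_divide_distrib)
    qed
    then show ?thesis unfolding integral_C01_lincomb[OF ul g 1] z by simp
  qed
  then show ?thesis by (meson abs_le_zero_iff dense not_le)
qed

text \<open>
  The difference quotients of \<open>T s f\<close> are the images under \<open>T s\<close> of those of \<open>f\<close>, and \<open>T s\<close> is a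
  contraction.
\<close>
lemma generator_invariant:
  assumes fs: "feller_semigroup T" and fg: "(f, g) \<in> generator T" and s: "s \<ge> 0"
  shows "(T s f, T s g) \<in> generator T"
proof -
  have f: "f \<in> C01" and g: "g \<in> C01" and
    ulim: "uniform_limit {0..1} (\<lambda>t x. (T t f x - f x) / t) g (at_right 0)"
    using fg unfolding generator_def by auto
  have TC: "\<And>t f. t \<ge> 0 \<Longrightarrow> f \<in> C01 \<Longrightarrow> T t f \<in> C01"
    by (rule feller_C01[OF fs])
  have lin: "T t (\<lambda>z. a * g z + b * h z) x = a * T t g x + b * T t h x"
    if "g \<in> C01" "h \<in> C01" "x \<in> {0..1}" "t \<ge> 0" for a b g h t x
    by (rule feller_lincomb[OF fs that(4,1,2,3)])
  have sg: "T (a + b) f x = T a (T b f) x" if "a \<ge> 0" "b \<ge> 0" "x \<in> {0..1}" for a b x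
    by (rule feller_add[OF fs that(1,2) f that(3)])
  have "uniform_limit {0..1} (\<lambda>t x. (T t (T s f) x - T s f x) / t) (T s g) (at_right 0)"
    unfolding uniform_limit_iff
  proof safe
    fix e :: real assume e: "e > 0"
    have "\<forall>\<^sub>F t in at_right 0. \<forall>x\<in>{0..1}. dist ((T t f x - f x) / t) (g x) < e/2"
      using ulim[unfolded uniform_limit_iff, rule_format, of "e/2"] e by simp
    moreover have "\<forall>\<^sub>F t in at_right (0::real). t > 0" by (rule eventually_at_right_less)
    ultimately show "\<forall>\<^sub>F t in at_right 0. \<forall>x\<in>{0..1}. dist ((T t (T s f) x - T s f x) / t) (T s g x) < e"
    proof eventually_elim
      case (elim t)
      show ?case
      proof
        fix x :: real assume x: "x \<in> {0..1}"
        have Tf: "T t f \<in> C01" using TC elim f by simp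
        define h where "h = (\<lambda>z. (1/t) * T t f z + (-1/t) * f z)"
        have h: "h \<in> C01" unfolding h_def by (rule C01_lincomb[OF Tf f])
        have "\<bar>T s (\<lambda>z. 1 * h z + (-1) * g z) x\<bar> \<le> e/2"
        proof (rule feller_contraction[OF fs s C01_lincomb[OF h g] _ x])
          fix z :: real assume "z \<in> {0..1}"
          with elim have "dist ((T t f z - f z) / t) (g z) < e/2" by blast
          then show "\<bar>1 * h z + (-1) * g z\<bar> \<le> e/2"
            by (simp add: h_def dist_real_def diff_divide_distrib)
        qed
        also have "T s (\<lambda>z. 1 * h z + (-1) * g z) x = T s h x - T s g x"
          using lin[OF h g x s, of 1 "-1"] by simp
        also have "T s h x = (1/t) * T s (T t f) x + (-1/t) * T s f x"
          unfolding h_def by (rule lin[OF Tf f x s])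
        also have "T s (T t f) x = T t (T s f) x"
          using sg[of s t x] sg[of t s x] s elim x by (simp add: add.commute)
        finally show "dist ((T t (T s f) x - T s f x) / t) (T s g x) < e"
          using e by (simp add: dist_real_def diff_divide_distrib)
      qed
    qed
  qed
  then show ?thesis using TC f g s unfolding generator_def by auto
qed

text \<open>
  Along a trajectory \<open>T s f\<close> the mean changes over a time step \<open>h\<close> by \<open>o(h)\<close>, uniformly in \<open>s\<close>:
  by contractivity the error of the difference quotient at time \<open>s\<close> is at most the one at time \<open>0\<close>, and
  the derivative \<open>T s g\<close> has mean zero. Chopping \<open>[0,t]\<close> into small steps shows that the mean does not
  change at all. Density of the polynomials carries this over to all continuous functions.
\<close>
lemma generator_null_imp_stationary:
  assumes fs: "feller_semigroup T" and ul: "unit_law \<mu>"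
    and null: "\<And>f g. (f, g) \<in> generator T \<Longrightarrow> (\<integral>x. g x \<partial>\<mu>) = 0"
    and dom: "\<And>p. \<exists>g. (poly p, g) \<in> generator T"
  shows "stationary_distribution T \<mu>"
proof -
  have TC: "\<And>t f. t \<ge> 0 \<Longrightarrow> f \<in> C01 \<Longrightarrow> T t f \<in> C01"
    by (rule feller_C01[OF fs])
  have lin: "T t (\<lambda>z. a * g z + b * h z) x = a * T t g x + b * T t h x"
    if "g \<in> C01" "h \<in> C01" "x \<in> {0..1}" "t \<ge> 0" for a b g h t x
    by (rule feller_lincomb[OF fs that(4,1,2,3)])
  have sg: "T (a + b) f x = T a (T b f) x" if "a \<ge> 0" "b \<ge> 0" "x \<in> {0..1}" "f \<in> C01" for a b x f
    by (rule feller_add[OF fs that(1,2,4,3)])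
  have T0: "T 0 f x = f x" if "f \<in> C01" "x \<in> {0..1}" for f x
    by (rule feller_zero[OF fs that])
  have domain: "(\<integral>x. T t f x \<partial>\<mu>) = (\<integral>x. f x \<partial>\<mu>)" if fg: "(f, g) \<in> generator T" and t: "t \<ge> 0" for f g t
  proof (cases "t = 0")
    case True then show ?thesis using fg T0 by (intro C01_integral_cong[OF ul]) (auto simp: generator_def)
  next
    case False
    with t have t: "t > 0" by simp
    have f: "f \<in> C01" and g: "g \<in> C01" and
      ulim: "uniform_limit {0..1} (\<lambda>t x. (T t f x - f x) / t) g (at_right 0)"
      using fg unfolding generator_def by auto
    define \<phi> where "\<phi> s = (\<integral>x. T s f x \<partial>\<mu>)" for s
    \<comment> \<open>compare \<open>\<phi>\<close> at the ends of steps shorter than the scale on which the difference quotient is \<open>e\<close>-close\<close>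
    have "\<bar>\<phi> t - \<phi> 0\<bar> \<le> e * t" if e: "e > 0" for e
    proof -
      have "\<forall>\<^sub>F t in at_right 0. \<forall>x\<in>{0..1}. dist ((T t f x - f x) / t) (g x) < e"
        using ulim[unfolded uniform_limit_iff, rule_format, OF e] .
      then obtain d where d: "d > 0" "\<And>h x. 0 < h \<Longrightarrow> h < d \<Longrightarrow> x \<in> {0..1} \<Longrightarrow> dist ((T h f x - f x) / h) (g x) < e"
        unfolding eventually_at_right_field by (auto simp: field_simps)
      have step: "\<bar>\<phi> (s + h) - \<phi> s\<bar> \<le> e * h" if s: "s \<ge> 0" and h: "0 < h" "h < d" for s h
      proof -
        have Tf: "T h f \<in> C01" using TC h f by simp
        define k where "k = (\<lambda>z. (1/h) * T h f z + (-1/h) * f z)"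
        have k: "k \<in> C01" unfolding k_def by (rule C01_lincomb[OF Tf f])
        define r where "r = (\<lambda>z. 1 * k z + (-1) * g z)"
        have r: "r \<in> C01" unfolding r_def by (rule C01_lincomb[OF k g])
        have "\<bar>r z\<bar> \<le> e" if "z \<in> {0..1}" for z
          using d(2)[OF h that] by (simp add: r_def k_def dist_real_def diff_divide_distrib)
        hence "\<bar>T s r x\<bar> \<le> e" if "x \<in> {0..1}" for x
          using feller_contraction[OF fs s r _ that] by blast
        hence "\<bar>\<integral>x. T s r x \<partial>\<mu>\<bar> \<le> e" using C01_integral_bound[OF ul TC[OF s r]] by blast
        also have "(\<integral>x. T s r x \<partial>\<mu>) = (\<integral>x. 1 * T s k x + (-1) * T s g x \<partial>\<mu>)"
          unfolding r_def by (rule C01_integral_cong[OF ul lin[OF k g _ s]])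
        also have "\<dots> = (\<integral>x. T s k x \<partial>\<mu>)"
          unfolding integral_C01_lincomb[OF ul TC[OF s k] TC[OF s g]]
          using null[OF generator_invariant[OF fs fg s]] by simp
        also have "\<dots> = (\<integral>x. (1/h) * T (s + h) f x + (-1/h) * T s f x \<partial>\<mu>)"
          unfolding k_def
        proof (rule C01_integral_cong[OF ul])
          fix x :: real assume x: "x \<in> {0..1}"
          show "T s (\<lambda>z. 1 / h * T h f z + - 1 / h * f z) x = 1 / h * T (s + h) f x + - 1 / h * T s f x"
            unfolding lin[OF Tf f x s] using sg[of s h x f] s h f x by simp
        qed
        also have "\<dots> = (1/h) * \<phi> (s + h) + (-1/h) * \<phi> s"
          unfolding \<phi>_def using s h by (intro integral_C01_lincomb[OF ul] TC f) auto
        also have "\<dots> = (\<phi> (s + h) - \<phi> s) / h" by (simp add: diff_divide_distrib)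
        finally show ?thesis using h by (simp add: abs_divide field_simps)
      qed
      \<comment> \<open>enough steps for each to be shorter than \<open>d\<close>\<close>
      obtain n :: nat where n: "t / d < real n" using reals_Archimedean2 by blast
      have n0: "n > 0" using n t d by (metis divide_pos_pos gr0I of_nat_0 order_less_asym)
      define h where "h = t / n"
      have h: "0 < h" "h < d" using n n0 t d by (auto simp: h_def field_simps)
      have "\<bar>\<phi> (real m * h) - \<phi> 0\<bar> \<le> e * (real m * h)" for m
      proof (induction m)
        case (Suc m)
        have "\<bar>\<phi> (real m * h + h) - \<phi> (real m * h)\<bar> \<le> e * h" using h by (intro step) auto
        then show ?case using Suc by (simp add: algebra_simps)
      qed simp
      from this[of n] show ?thesis using n0 by (simp add: h_def)
    qed
    hence A: "\<bar>\<phi> t - \<phi> 0\<bar> \<le> e * t" if "e > 0" for e using that by blast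
    have "\<bar>\<phi> t - \<phi> 0\<bar> \<le> e" if "e > 0" for e
      using A[of "e / t"] that t by simp
    hence "\<phi> t = \<phi> 0" by (metis abs_le_zero_iff dense not_le eq_iff_diff_eq_0)
    then show ?thesis unfolding \<phi>_def using C01_integral_cong[OF ul T0[OF f]] by simp
  qed
  have "(\<integral>x. T t f x \<partial>\<mu>) = (\<integral>x. f x \<partial>\<mu>)" if t: "t \<ge> 0" and f: "f \<in> C01" for t f
  proof -
    obtain p where p: "uniform_limit {0..1} (\<lambda>n. poly (p n)) f sequentially"
      using C01_poly_approx[OF f] .
    have eq: "(\<integral>x. T t (poly (p n)) x \<partial>\<mu>) = (\<integral>x. poly (p n) x \<partial>\<mu>)" for n
      using dom[of "p n"] domain t by blast
    have "uniform_limit {0..1} (\<lambda>n. T t (poly (p n))) (T t f) sequentially"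
      unfolding uniform_limit_iff
    proof safe
      fix e :: real assume e: "e > 0"
      have "\<forall>\<^sub>F n in sequentially. \<forall>x\<in>{0..1}. dist (poly (p n) x) (f x) < e/2"
        using p[unfolded uniform_limit_iff, rule_format, of "e/2"] e by simp
      then show "\<forall>\<^sub>F n in sequentially. \<forall>x\<in>{0..1}. dist (T t (poly (p n)) x) (T t f x) < e"
      proof eventually_elim
        case (elim n)
        show ?case
        proof
          fix x :: real assume x: "x \<in> {0..1}"
          have "\<bar>T t (\<lambda>z. 1 * poly (p n) z + (-1) * f z) x\<bar> \<le> e/2"
            using elim by (intro feller_contraction[OF fs t C01_lincomb[OF C01_poly f] _ x])
              (auto simp: dist_real_def intro: less_imp_le)
          then show "dist (T t (poly (p n)) x) (T t f x) < e"
            unfolding lin[OF C01_poly f x t] using e by (simp add: dist_real_def)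
        qed
      qed
    qed
    from C01_integral_uniform_limit[OF ul TC[OF t C01_poly] TC[OF t f] this]
      C01_integral_uniform_limit[OF ul C01_poly f p]
    show ?thesis using LIMSEQ_unique unfolding eq by blast
  qed
  then show ?thesis using ul unfolding stationary_distribution_def unit_law_def by blast
qed

section \<open>Beta integrals\<close>

lemma beta_mixed_moment:
  fixes a b :: real assumes a: "a > 0" and b: "b > 0"
  shows "has_bochner_integral (beta_distribution a b) (\<lambda>u. u ^ i * (1 - u) ^ j)
           (pochhammer a i * pochhammer b j / pochhammer (a + b) (i + j))"
proof -
  define C where "C = Gamma (a + b) / (Gamma a * Gamma b)"
  have G: "Gamma a > 0" "Gamma b > 0" "Gamma (a + b) > 0" using a b by (auto intro: Gamma_real_pos)
  hence C: "C \<ge> 0" by (auto simp: C_def)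
  define g where "g = (\<lambda>x::real. indicator {0..1} x * C * x powr (a - 1) * (1 - x) powr (b - 1))"
  define h where "h = (\<lambda>x::real. x powr (a + real i - 1) * (1 - x) powr (b + real j - 1))"
  have hint: "set_integrable lborel {0..1} h"
    unfolding h_def using a b by (intro integrable_Beta) auto
  have "(LINT x:{0..1}|lborel. h x) = Beta (a + real i) (b + real j)"
    unfolding h_def using a b
    by (intro trans[OF set_borel_integral_eq_integral(2)[OF hint[unfolded h_def]]
        integral_unique[OF has_integral_Beta_real]]) auto
  hence hb: "has_bochner_integral lborel (\<lambda>x. indicator {0..1} x *\<^sub>R h x) (Beta (a + real i) (b + real j))"
    using hint unfolding set_integrable_def set_lebesgue_integral_def has_bochner_integral_iff by blast
  have gh: "g x *\<^sub>R (x ^ i * (1 - x) ^ j) = C * (indicator {0..1} x *\<^sub>R h x)" for x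
  proof (cases "0 < x \<and> x < 1")
    case True
    then have "x powr (a + real i - 1) = x powr (a - 1) * x ^ i"
              "(1 - x) powr (b + real j - 1) = (1 - x) powr (b - 1) * (1 - x) ^ j"
      by (simp_all add: powr_realpow[symmetric] powr_add[symmetric] algebra_simps)
    then show ?thesis by (simp add: g_def h_def)
  next
    case False
    then have "x = 0 \<or> x = 1 \<or> x \<notin> {0..1}" by auto
    then show ?thesis by (auto simp: g_def h_def)
  qed
  have dens: "beta_distribution a b = density lborel (\<lambda>x. ennreal (g x))"
    by (simp add: beta_distribution_def g_def C_def)
  have "has_bochner_integral (beta_distribution a b) (\<lambda>u. u ^ i * (1 - u) ^ j) (C * Beta (a + real i) (b + real j))"
    unfolding dens
  proof (rule has_bochner_integral_density)
    show "has_bochner_integral lborel (\<lambda>x. g x *\<^sub>R (x ^ i * (1 - x) ^ j)) (C * Beta (a + real i) (b + real j))"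
      unfolding gh by (intro has_bochner_integral_mult_right hb)
  qed (use C in \<open>auto simp: g_def\<close>)
  also have "C * Beta (a + real i) (b + real j) = pochhammer a i * pochhammer b j / pochhammer (a + b) (i + j)"
  proof -
    have n: "a \<notin> \<int>\<^sub>\<le>\<^sub>0" "b \<notin> \<int>\<^sub>\<le>\<^sub>0" "a + b \<notin> \<int>\<^sub>\<le>\<^sub>0" using a b by auto
    show ?thesis
      using G n by (simp add: C_def Beta_def pochhammer_Gamma algebra_simps divide_simps)
  qed
  finally show ?thesis .
qed

lemma sets_beta_distribution [measurable_cong]: "sets (beta_distribution a b) = sets borel"
  by (simp add: beta_distribution_def)

lemma space_beta_distribution: "space (beta_distribution a b) = UNIV"
  by (simp add: beta_distribution_def)

text \<open>
  At the endpoints the density vanishes because of \<open>0 powr r = 0\<close>, even where the exponent is negative.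
\<close>
lemma AE_beta_distribution: "AE u in beta_distribution a b. 0 < u \<and> u < 1"
  unfolding beta_distribution_def
  by (subst AE_density) (auto simp: indicator_def not_less order.order_iff_strict)

lemma prob_space_beta_distribution:
  assumes "a > 0" "b > 0" shows "prob_space (beta_distribution a b)"
proof -
  have "has_bochner_integral (beta_distribution a b) (\<lambda>_. 1) (1::real)"
    using beta_mixed_moment[OF assms, of 0 0] by simp
  hence "integrable (beta_distribution a b) (\<lambda>_. 1::real)" "integral\<^sup>L (beta_distribution a b) (\<lambda>_. 1::real) = 1"
    by (auto simp: has_bochner_integral_iff)
  hence "(\<integral>\<^sup>+_. ennreal 1 \<partial>beta_distribution a b) = ennreal 1"
    by (subst nn_integral_eq_integral) auto
  then show ?thesis by (intro prob_spaceI) simp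
qed

section \<open>The operator on powers\<close>

text \<open>
  The left-hand side of the first-order differential equation
  \<open>((1+z)\<^sup>\<alpha> - 1) (1+z) F'(z) + \<alpha> (c\<^sub>2 - 1 + c\<^sub>1 (1+z)\<^sup>\<alpha>) F(z) = const\<close>, read as an identity of formal
  power series. In the variable \<open>x = 1 - (1+z)\<^sup>\<alpha>\<close> it is, up to the factor \<open>\<alpha>\<close>, the inhomogeneous
  equation satisfied by the hypergeometric function \<open>\<^sub>2F\<^sub>1(1, c\<^sub>1; c\<^sub>1 + c\<^sub>2; x)\<close>.
\<close>
definition moment_ode :: "real \<Rightarrow> real \<Rightarrow> real \<Rightarrow> real fps \<Rightarrow> real fps" where
  "moment_ode \<alpha> c1 c2 F =
     (fps_binomial \<alpha> - 1) * (1 + fps_X) * fps_deriv F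
     + fps_const \<alpha> * (fps_const (c2 - 1) + fps_const c1 * fps_binomial \<alpha>) * F"

text \<open>
  The two occurrences of the coefficient of index \<open>m + 2\<close> cancel, because
  \<open>((1+z)\<^sup>\<alpha> - 1) (1+z)\<close> has no constant term. So this is a recursion: it determines the coefficient of
  index \<open>m + 1\<close> from the lower ones.
\<close>
lemma moment_ode_nth:
  "fps_nth (moment_ode \<alpha> c1 c2 F) (Suc m) =
     \<alpha> * (real m + c1 + c2) * fps_nth F (Suc m)
     + (\<Sum>k<m. ((\<alpha> + 1) gchoose (Suc m - k)) * real (Suc k) * fps_nth F (Suc k))
     + \<alpha> * c1 * (\<Sum>k<Suc m. (\<alpha> gchoose (Suc m - k)) * fps_nth F k)"
proof -
  have "fps_binomial (\<alpha> + 1) = fps_binomial \<alpha> * (1 + fps_X)"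
    by (simp add: fps_binomial_add_mult fps_binomial_1)
  hence e: "moment_ode \<alpha> c1 c2 F = fps_deriv F * fps_binomial (\<alpha> + 1) - (1 + fps_X) * fps_deriv F
     + fps_const (\<alpha> * (c2 - 1)) * F + fps_const (\<alpha> * c1) * (F * fps_binomial \<alpha>)"
    unfolding moment_ode_def by (simp add: algebra_simps flip: fps_const_mult fps_const_sub)
  have n1: "fps_nth (fps_deriv F * fps_binomial (\<alpha> + 1)) (Suc m) =
      (\<Sum>k<m. ((\<alpha> + 1) gchoose (Suc m - k)) * real (Suc k) * fps_nth F (Suc k))
      + (\<alpha> + 1) * real (Suc m) * fps_nth F (Suc m) + real (Suc (Suc m)) * fps_nth F (Suc (Suc m))"
    by (simp add: fps_mult_nth atLeast0AtMost lessThan_Suc_atMost[symmetric] mult_ac)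
  have n2: "fps_nth (F * fps_binomial \<alpha>) (Suc m) =
      (\<Sum>k<Suc m. (\<alpha> gchoose (Suc m - k)) * fps_nth F k) + fps_nth F (Suc m)"
    by (simp add: fps_mult_nth atLeast0AtMost lessThan_Suc_atMost[symmetric] mult_ac del: sum.lessThan_Suc)
       (simp add: mult_ac)
  have n3: "fps_nth ((1 + fps_X) * fps_deriv F) (Suc m) =
      real (Suc (Suc m)) * fps_nth F (Suc (Suc m)) + real (Suc m) * fps_nth F (Suc m)"
    by (simp add: distrib_right)
  show ?thesis unfolding e fps_add_nth fps_sub_nth fps_mult_left_const_nth n1 n2 n3
    by (simp add: algebra_simps del: sum.lessThan_Suc)
qed

text \<open>
  The expansion in powers of \<open>z\<close> of \<open>\<integral> (1 + z x)\<^sup>-\<^sup>\<alpha> \<mu>(dx)\<close>, where \<open>m\<close> is the moment sequence of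
  \<open>\<mu>\<close>.
\<close>
definition moment_series :: "real \<Rightarrow> (nat \<Rightarrow> real) \<Rightarrow> real fps" where
  "moment_series \<alpha> m = Abs_fps (\<lambda>n. ((- \<alpha>) gchoose n) * m n)"

text \<open>
  The bracket in the first integral of the operator, for \<open>G(x) = x\<^sup>n\<close>, is divisible by \<open>u\<^sup>2\<close>: the
  terms with at most one factor \<open>u\<close> in the binomial expansion of \<open>((1-u) x + u)\<^sup>n\<close> combine with the
  rest of the bracket to \<open>- x\<^sup>n (1 - (1-u)\<^sup>n - n u (1-u)\<^sup>n\<^sup>-\<^sup>1)\<close>. The quotient is written in terms of \<open>u\<^sup>i (1-u)\<^sup>j\<close>, whose
  beta integrals are explicit.
\<close>
lemma quadratic_quotient:
  fixes x u :: real
  shows "x * ((1 - u) * x + u) ^ Suc m + (1 - x) * ((1 - u) * x) ^ Suc m - x ^ Suc m =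
    u\<^sup>2 * ((\<Sum>k<m. real (Suc m choose k) * (u ^ (m - 1 - k) * (1 - u) ^ k) * x ^ Suc k)
          - x ^ Suc m * (\<Sum>i<m. real (Suc i) * (1 - u) ^ i))"
proof -
  have 1: "u\<^sup>2 * (\<Sum>i<m. real (Suc i) * (1 - u) ^ i) = 1 - (1 - u) ^ Suc m - real (Suc m) * u * (1 - u) ^ m"
    by (induction m) (simp_all add: algebra_simps power2_eq_square)
  have "((1 - u) * x + u) ^ Suc m = (\<Sum>k<Suc (Suc m). real (Suc m choose k) * ((1 - u) * x) ^ k * u ^ (Suc m - k))"
    by (simp only: binomial_ring lessThan_Suc_atMost)
  also have "\<dots> = (\<Sum>k<m. real (Suc m choose k) * ((1 - u) * x) ^ k * u ^ (Suc m - k))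
      + real (Suc m) * ((1 - u) * x) ^ m * u + ((1 - u) * x) ^ Suc m"
    by simp
  also have "(\<Sum>k<m. real (Suc m choose k) * ((1 - u) * x) ^ k * u ^ (Suc m - k))
    = u\<^sup>2 * (\<Sum>k<m. real (Suc m choose k) * (u ^ (m - 1 - k) * (1 - u) ^ k) * x ^ k)"
    unfolding sum_distrib_left
  proof (intro sum.cong refl)
    fix k assume "k \<in> {..<m}"
    hence "Suc m - k = 2 + (m - 1 - k)" by auto
    hence "u ^ (Suc m - k) = u\<^sup>2 * u ^ (m - 1 - k)" by (metis power_add)
    then show "real (Suc m choose k) * ((1 - u) * x) ^ k * u ^ (Suc m - k)
      = u\<^sup>2 * (real (Suc m choose k) * (u ^ (m - 1 - k) * (1 - u) ^ k) * x ^ k)"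
      by (simp add: power_mult_distrib)
  qed
  finally have 2: "x * ((1 - u) * x + u) ^ Suc m =
    u\<^sup>2 * (\<Sum>k<m. real (Suc m choose k) * (u ^ (m - 1 - k) * (1 - u) ^ k) * x ^ Suc k)
    + real (Suc m) * (1 - u) ^ m * x ^ Suc m * u + x * ((1 - u) * x) ^ Suc m"
    by (simp add: distrib_left sum_distrib_left power_mult_distrib mult_ac)
  show ?thesis
    unfolding right_diff_distrib mult.left_commute[of "u\<^sup>2" "x ^ Suc m"] 1 2
    unfolding power_mult_distrib by (simp add: algebra_simps)
qed

text \<open>
  The analogue for the bracket in the second integral, from which one factor \<open>u\<close> is split off.
\<close>
lemma linear_quotient:
  fixes x u c1 c2 :: real
  shows "c1 * ((1 - u) * x + u) ^ n + c2 * ((1 - u) * x) ^ n - (c1 + c2) * x ^ n =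
    u * (c1 * (\<Sum>k<n. real (n choose k) * (u ^ (n - 1 - k) * (1 - u) ^ k) * x ^ k)
         - (c1 + c2) * x ^ n * (\<Sum>i<n. (1 - u) ^ i))"
proof -
  have 1: "u * (\<Sum>i<n. (1 - u) ^ i) = 1 - (1 - u) ^ n"
    by (induction n) (simp_all add: algebra_simps)
  have "((1 - u) * x + u) ^ n = (\<Sum>k<Suc n. real (n choose k) * ((1 - u) * x) ^ k * u ^ (n - k))"
    by (simp only: binomial_ring lessThan_Suc_atMost)
  also have "\<dots> = (\<Sum>k<n. real (n choose k) * ((1 - u) * x) ^ k * u ^ (n - k)) + ((1 - u) * x) ^ n"
    by simp
  also have "(\<Sum>k<n. real (n choose k) * ((1 - u) * x) ^ k * u ^ (n - k))
    = u * (\<Sum>k<n. real (n choose k) * (u ^ (n - 1 - k) * (1 - u) ^ k) * x ^ k)"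
    unfolding sum_distrib_left
  proof (intro sum.cong refl)
    fix k assume "k \<in> {..<n}"
    hence "n - k = Suc (n - 1 - k)" by auto
    hence "u ^ (n - k) = u * u ^ (n - 1 - k)" by simp
    then show "real (n choose k) * ((1 - u) * x) ^ k * u ^ (n - k)
      = u * (real (n choose k) * (u ^ (n - 1 - k) * (1 - u) ^ k) * x ^ k)"
      by (simp add: power_mult_distrib)
  qed
  finally have 2: "((1 - u) * x + u) ^ n = \<dots> + ((1 - u) * x) ^ n" .
  show ?thesis
    unfolding right_diff_distrib mult.left_commute[of u "(c1 + c2) * x ^ n"] 1 2
    unfolding power_mult_distrib by (simp add: algebra_simps)
qed

lemma sum_pochhammer_div_fact:
  "(\<Sum>i<Suc m. pochhammer a i / fact i) = pochhammer (a + 1) m / (fact m :: real)"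
proof (induction m)
  case (Suc m)
  define p where "p = pochhammer (a + 1) m"
  define k where "k = real m + 1"
  have k: "k \<noteq> 0" "(fact m :: real) \<noteq> 0" and f: "fact (Suc m) = k * fact m" by (auto simp: k_def)
  have 1: "pochhammer (a + 1) (Suc m) = p * (a + k)" by (simp add: pochhammer_Suc p_def k_def)
  have 2: "pochhammer a (Suc m) = a * p" by (simp add: pochhammer_rec p_def)
  have "(\<Sum>i<Suc (Suc m). pochhammer a i / fact i) = p / fact m + a * p / (k * fact m)"
    using Suc by (simp only: sum.lessThan_Suc[of _ "Suc m"] 2 f p_def)
  also have "\<dots> = p * (a + k) / (k * fact m)" using k by (simp add: field_simps)
  finally show ?case unfolding 1 f .
qed simp

lemma sum_shifted_pochhammer_div_fact:
  assumes "a > -1"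
  shows "(\<Sum>i<m. pochhammer (a + 1) i / fact i) = real m * pochhammer (a + 1) m / ((a + 1) * (fact m :: real))"
proof (induction m)
  case (Suc m)
  define p where "p = pochhammer (a + 1) m"
  define k where "k = real m + 1"
  have k: "k \<noteq> 0" "(fact m :: real) \<noteq> 0" and f: "fact (Suc m) = k * fact m" by (auto simp: k_def)
  have a: "a + 1 \<noteq> 0" using assms by simp
  have m: "real m = k - 1" "real (Suc m) = k" by (simp_all add: k_def)
  have 1: "pochhammer (a + 1) (Suc m) = p * (a + k)" by (simp add: pochhammer_Suc p_def k_def)
  have "(\<Sum>i<Suc m. pochhammer (a + 1) i / fact i) = (k - 1) * p / ((a + 1) * fact m) + p / fact m"
    using Suc by (simp only: sum.lessThan_Suc m p_def)
  also have "\<dots> = k * (p * (a + k)) / ((a + 1) * (k * fact m))" using k a by (simp add: divide_simps) (simp add: algebra_simps)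
  finally show ?case unfolding 1 f m .
qed simp

text \<open>
  In the binomial sum the exponents of \<open>u\<close> and \<open>1-u\<close> add up to \<open>m - 1\<close>, so that all beta integrals
  have the same denominator, the Pochhammer symbol of \<open>2\<close> of order \<open>m - 1\<close>, which is \<open>m!\<close>.
\<close>
lemma has_integral_A_quadratic:
  assumes "0 < \<alpha>" "\<alpha> < 1"
  shows "has_bochner_integral (beta_distribution (1 - \<alpha>) (1 + \<alpha>))
     (\<lambda>u. (x * ((1 - u) * x + u) ^ Suc m + (1 - x) * ((1 - u) * x) ^ Suc m - x ^ Suc m) / u\<^sup>2)
     ((\<Sum>k<m. real (Suc m choose k) * (pochhammer (1 - \<alpha>) (m - 1 - k) * pochhammer (1 + \<alpha>) k / fact m) * x ^ Suc k)
     - x ^ Suc m * (real m * pochhammer (\<alpha> + 1) m / ((\<alpha> + 1) * fact m)))"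
proof -
  let ?B = "beta_distribution (1 - \<alpha>) (1 + \<alpha>)"
  have B: "has_bochner_integral ?B (\<lambda>u. u ^ i * (1 - u) ^ j) (pochhammer (1 - \<alpha>) i * pochhammer (1 + \<alpha>) j / fact (Suc (i + j)))" for i j
    using beta_mixed_moment[of "1 - \<alpha>" "1 + \<alpha>" i j] assms pochhammer_fact[of "Suc (i + j)", where 'a = real]
    by (simp add: pochhammer_rec)
  have hb: "has_bochner_integral ?B (\<lambda>u. (\<Sum>k<m. real (Suc m choose k) * (u ^ (m - 1 - k) * (1 - u) ^ k) * x ^ Suc k)
          - x ^ Suc m * (\<Sum>i<m. real (Suc i) * (u ^ 0 * (1 - u) ^ i)))
      ((\<Sum>k<m. real (Suc m choose k) * (pochhammer (1 - \<alpha>) (m - 1 - k) * pochhammer (1 + \<alpha>) k / fact (Suc (m - 1 - k + k))) * x ^ Suc k)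
       - x ^ Suc m * (\<Sum>i<m. real (Suc i) * (pochhammer (1 - \<alpha>) 0 * pochhammer (1 + \<alpha>) i / fact (Suc (0 + i)))))"
    (is "has_bochner_integral _ ?f ?b")
    by (intro has_bochner_integral_diff has_bochner_integral_sum has_bochner_integral_mult_right has_bochner_integral_mult_left B)
  have ae: "AE u in ?B. ?f u = (x * ((1 - u) * x + u) ^ Suc m + (1 - x) * ((1 - u) * x) ^ Suc m - x ^ Suc m) / u\<^sup>2"
    using AE_beta_distribution[of "1 - \<alpha>" "1 + \<alpha>"] unfolding quadratic_quotient by eventually_elim simp
  have "(has_bochner_integral ?B ?f ?b) = (has_bochner_integral ?B (\<lambda>u. (x * ((1 - u) * x + u) ^ Suc m + (1 - x) * ((1 - u) * x) ^ Suc m - x ^ Suc m) / u\<^sup>2) ?b)"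
    by (rule has_bochner_integral_cong_AE[OF _ _ ae]) measurable
  with hb have "has_bochner_integral ?B (\<lambda>u. (x * ((1 - u) * x + u) ^ Suc m + (1 - x) * ((1 - u) * x) ^ Suc m - x ^ Suc m) / u\<^sup>2) ?b"
    by (simp only:)
  also have "?b = (\<Sum>k<m. real (Suc m choose k) * (pochhammer (1 - \<alpha>) (m - 1 - k) * pochhammer (1 + \<alpha>) k / fact m) * x ^ Suc k)
     - x ^ Suc m * (real m * pochhammer (\<alpha> + 1) m / ((\<alpha> + 1) * fact m))"
  proof (rule arg_cong2[where f = "(-)"])
    show "(\<Sum>k<m. real (Suc m choose k) * (pochhammer (1 - \<alpha>) (m - 1 - k) * pochhammer (1 + \<alpha>) k / fact (Suc (m - 1 - k + k))) * x ^ Suc k)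
      = (\<Sum>k<m. real (Suc m choose k) * (pochhammer (1 - \<alpha>) (m - 1 - k) * pochhammer (1 + \<alpha>) k / fact m) * x ^ Suc k)"
    proof (intro sum.cong refl)
      fix k assume "k \<in> {..<m}"
      hence "Suc (m - 1 - k + k) = m" by auto
      then show "real (Suc m choose k) * (pochhammer (1 - \<alpha>) (m - 1 - k) * pochhammer (1 + \<alpha>) k / fact (Suc (m - 1 - k + k))) * x ^ Suc k
        = real (Suc m choose k) * (pochhammer (1 - \<alpha>) (m - 1 - k) * pochhammer (1 + \<alpha>) k / fact m) * x ^ Suc k" by (simp only:)
    qed
    have "(\<Sum>i<m. real (Suc i) * (pochhammer (1 - \<alpha>) 0 * pochhammer (1 + \<alpha>) i / fact (Suc (0 + i))))
      = (\<Sum>i<m. pochhammer (\<alpha> + 1) i / fact i)"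
      by (intro sum.cong refl) (simp add: add.commute del: of_nat_Suc)
    then show "x ^ Suc m * (\<Sum>i<m. real (Suc i) * (pochhammer (1 - \<alpha>) 0 * pochhammer (1 + \<alpha>) i / fact (Suc (0 + i))))
      = x ^ Suc m * (real m * pochhammer (\<alpha> + 1) m / ((\<alpha> + 1) * fact m))"
      using sum_shifted_pochhammer_div_fact[of \<alpha> m] assms by simp
  qed
  finally show ?thesis .
qed

lemma has_integral_A_linear:
  assumes "0 < \<alpha>" "\<alpha> < 1"
  shows "has_bochner_integral (beta_distribution (1 - \<alpha>) \<alpha>)
     (\<lambda>u. (c1 * ((1 - u) * x + u) ^ Suc m + c2 * ((1 - u) * x) ^ Suc m - (c1 + c2) * x ^ Suc m) / ((\<alpha> + 1) * u))
     ((c1 * (\<Sum>k<Suc m. real (Suc m choose k) * (pochhammer (1 - \<alpha>) (m - k) * pochhammer \<alpha> k / fact m) * x ^ k)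
         - (c1 + c2) * x ^ Suc m * (pochhammer (\<alpha> + 1) m / fact m)) / (\<alpha> + 1))"
proof -
  let ?D = "beta_distribution (1 - \<alpha>) \<alpha>"
  have D: "has_bochner_integral ?D (\<lambda>u. u ^ i * (1 - u) ^ j) (pochhammer (1 - \<alpha>) i * pochhammer \<alpha> j / fact (i + j))" for i j
    using beta_mixed_moment[of "1 - \<alpha>" "\<alpha>" i j] assms pochhammer_fact[of "i + j", where 'a = real]
    by simp
  have hb: "has_bochner_integral ?D (\<lambda>u. (c1 * (\<Sum>k<Suc m. real (Suc m choose k) * (u ^ (Suc m - 1 - k) * (1 - u) ^ k) * x ^ k)
         - (c1 + c2) * x ^ Suc m * (\<Sum>i<Suc m. u ^ 0 * (1 - u) ^ i)) / (\<alpha> + 1))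
      ((c1 * (\<Sum>k<Suc m. real (Suc m choose k) * (pochhammer (1 - \<alpha>) (Suc m - 1 - k) * pochhammer \<alpha> k / fact (Suc m - 1 - k + k)) * x ^ k)
         - (c1 + c2) * x ^ Suc m * (\<Sum>i<Suc m. pochhammer (1 - \<alpha>) 0 * pochhammer \<alpha> i / fact (0 + i))) / (\<alpha> + 1))"
    (is "has_bochner_integral _ ?g ?d")
    by (intro has_bochner_integral_divide has_bochner_integral_diff has_bochner_integral_sum has_bochner_integral_mult_right has_bochner_integral_mult_left D)
  have ae: "AE u in ?D. ?g u = (c1 * ((1 - u) * x + u) ^ Suc m + c2 * ((1 - u) * x) ^ Suc m - (c1 + c2) * x ^ Suc m) / ((\<alpha> + 1) * u)"
    using AE_beta_distribution[of "1 - \<alpha>" "\<alpha>"] unfolding linear_quotient[of c1 _ x "Suc m" c2]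
    by eventually_elim (simp del: sum.lessThan_Suc)
  have "(has_bochner_integral ?D ?g ?d) = (has_bochner_integral ?D (\<lambda>u. (c1 * ((1 - u) * x + u) ^ Suc m + c2 * ((1 - u) * x) ^ Suc m - (c1 + c2) * x ^ Suc m) / ((\<alpha> + 1) * u)) ?d)"
    by (rule has_bochner_integral_cong_AE[OF _ _ ae]) measurable
  with hb have "has_bochner_integral ?D (\<lambda>u. (c1 * ((1 - u) * x + u) ^ Suc m + c2 * ((1 - u) * x) ^ Suc m - (c1 + c2) * x ^ Suc m) / ((\<alpha> + 1) * u)) ?d"
    by (simp only:)
  also have "?d = (c1 * (\<Sum>k<Suc m. real (Suc m choose k) * (pochhammer (1 - \<alpha>) (m - k) * pochhammer \<alpha> k / fact m) * x ^ k)
         - (c1 + c2) * x ^ Suc m * (pochhammer (\<alpha> + 1) m / fact m)) / (\<alpha> + 1)"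
  proof -
    have "(\<Sum>k<Suc m. real (Suc m choose k) * (pochhammer (1 - \<alpha>) (Suc m - 1 - k) * pochhammer \<alpha> k / fact (Suc m - 1 - k + k)) * x ^ k)
      = (\<Sum>k<Suc m. real (Suc m choose k) * (pochhammer (1 - \<alpha>) (m - k) * pochhammer \<alpha> k / fact m) * x ^ k)"
      by (intro sum.cong refl) auto
    moreover have "(\<Sum>i<Suc m. pochhammer (1 - \<alpha>) 0 * pochhammer \<alpha> i / fact (0 + i)) = pochhammer (\<alpha> + 1) m / fact m"
      using sum_pochhammer_div_fact[of \<alpha> m] by simp
    ultimately show ?thesis by (simp only:)
  qed
  finally show ?thesis .
qed

lemma A_op_power:
  assumes "0 < \<alpha>" "\<alpha> < 1"
  shows "A_op \<alpha> c1 c2 (\<lambda>x. x ^ Suc m) x =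
     (\<Sum>k<m. real (Suc m choose k) * (pochhammer (1 - \<alpha>) (m - 1 - k) * pochhammer (1 + \<alpha>) k / fact m) * x ^ Suc k)
     - x ^ Suc m * (real m * pochhammer (\<alpha> + 1) m / ((\<alpha> + 1) * fact m))
     + (c1 * (\<Sum>k<Suc m. real (Suc m choose k) * (pochhammer (1 - \<alpha>) (m - k) * pochhammer \<alpha> k / fact m) * x ^ k)
         - (c1 + c2) * x ^ Suc m * (pochhammer (\<alpha> + 1) m / fact m)) / (\<alpha> + 1)"
  unfolding A_op_def
    has_bochner_integral_integral_eq[OF has_integral_A_quadratic[OF assms]]
    has_bochner_integral_integral_eq[OF has_integral_A_linear[OF assms]] ..

lemma A_op_poly:
  assumes "0 < \<alpha>" "\<alpha> < 1"
  shows "A_op \<alpha> c1 c2 (poly p) x = (\<Sum>n\<le>degree p. coeff p n * A_op \<alpha> c1 c2 (\<lambda>x. x ^ n) x)"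
proof -
  let ?B = "beta_distribution (1 - \<alpha>) (1 + \<alpha>)" and ?D = "beta_distribution (1 - \<alpha>) \<alpha>"
  let ?q = "\<lambda>n u. (x * ((1 - u) * x + u) ^ n + (1 - x) * ((1 - u) * x) ^ n - x ^ n) / u\<^sup>2"
  let ?l = "\<lambda>n u. (c1 * ((1 - u) * x + u) ^ n + c2 * ((1 - u) * x) ^ n - (c1 + c2) * x ^ n) / ((\<alpha> + 1) * u)"
  have q: "integrable ?B (?q n)" for n
  proof (cases n)
    case (Suc m) then show ?thesis using has_integral_A_quadratic[OF assms, of x m] by (auto simp only: has_bochner_integral_iff)
  qed simp
  have l: "integrable ?D (?l n)" for n
  proof (cases n)
    case (Suc m) then show ?thesis using has_integral_A_linear[OF assms, of c1 x m c2] by (auto simp only: has_bochner_integral_iff)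
  qed simp
  have "(x * poly p ((1 - u) * x + u) + (1 - x) * poly p ((1 - u) * x) - poly p x) / u\<^sup>2
      = (\<Sum>n\<le>degree p. coeff p n * ?q n u)" for u
    unfolding poly_altdef sum_distrib_left sum.distrib[symmetric] sum_subtractf[symmetric] sum_divide_distrib
    by (intro sum.cong refl) (simp add: algebra_simps add_divide_distrib diff_divide_distrib)
  moreover have "(c1 * poly p ((1 - u) * x + u) + c2 * poly p ((1 - u) * x) - (c1 + c2) * poly p x) / ((\<alpha> + 1) * u)
      = (\<Sum>n\<le>degree p. coeff p n * ?l n u)" for u
    unfolding poly_altdef sum_distrib_left sum.distrib[symmetric] sum_subtractf[symmetric] sum_divide_distrib
    by (intro sum.cong refl) (simp add: algebra_simps add_divide_distrib diff_divide_distrib)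
  ultimately show ?thesis
    unfolding A_op_def
    by (simp only: Bochner_Integration.integral_sum[OF integrable_mult_right[OF q]]
        Bochner_Integration.integral_sum[OF integrable_mult_right[OF l]] integral_mult_right_zero
        sum.distrib[symmetric] distrib_left)
qed

lemma gchoose_minus: "((- \<alpha>) gchoose k) = (- 1) ^ k * pochhammer \<alpha> k / (fact k :: real)"
  by (simp add: gbinomial_pochhammer)

lemma gchoose_minus_nonzero: "\<alpha> > 0 \<Longrightarrow> ((- \<alpha>) gchoose n) \<noteq> (0 :: real)"
  using pochhammer_pos[of \<alpha> n] by (simp add: gchoose_minus)

lemma gchoose_Suc: "(\<alpha> gchoose Suc j) = (- 1) ^ j * \<alpha> * pochhammer (1 - \<alpha>) j / (fact (Suc j) :: real)"
  by (simp add: gbinomial_pochhammer pochhammer_rec del: fact_Suc)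

lemma gchoose_plus_1_Suc_Suc:
  "((\<alpha> + 1) gchoose Suc (Suc j)) = (- 1) ^ j * \<alpha> * (\<alpha> + 1) * pochhammer (1 - \<alpha>) j / (fact (Suc (Suc j)) :: real)"
  by (simp add: gbinomial_pochhammer pochhammer_rec algebra_simps del: fact_Suc)

text \<open>
  Coefficient by coefficient, and up to a factor, the operator acts on the function \<open>(1 + z x)\<^sup>-\<^sup>\<alpha>\<close> of
  \<open>x\<close> as the differential expression \<open>moment_ode\<close> does in the variable \<open>z\<close>: the sum
  of products of binomial coefficients and beta integrals that comes from a power of \<open>x\<close> is exactly the Cauchy product with \<open>(1+z)\<^sup>\<alpha>\<close> and \<open>(1+z)\<^sup>\<alpha>\<^sup>+\<^sup>1\<close>. The factor in front comes from the
  normalizations of the beta laws and of the coefficients of \<open>(1 + z x)\<^sup>-\<^sup>\<alpha>\<close>.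
\<close>
lemma A_op_power_moment_ode:
  assumes "0 < \<alpha>" "\<alpha> < 1"
  shows "\<alpha>\<^sup>2 * (\<alpha> + 1) * (- 1) ^ m / real (Suc m) * A_op \<alpha> c1 c2 (\<lambda>x. x ^ Suc m) x =
         fps_nth (moment_ode \<alpha> c1 c2 (moment_series \<alpha> (\<lambda>k. x ^ k))) (Suc m)"
proof -
  define \<kappa> where "\<kappa> = \<alpha>\<^sup>2 * (\<alpha> + 1) * (- 1) ^ m / real (Suc m)"
  define p where "p = pochhammer (\<alpha> + 1) m"
  define F where "F = (fact m :: real)"
  define N where "N = real (Suc m)"
  have nz: "\<alpha> + 1 \<noteq> 0" "\<alpha> \<noteq> 0" "F \<noteq> 0" "N \<noteq> 0" using assms by (auto simp: F_def N_def)
  have FN: "fact (Suc m) = N * F" by (simp add: F_def N_def)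
  \<comment> \<open>the contribution of the highest power, where both integrals contribute\<close>
  have lead: "\<kappa> * (- (x ^ Suc m * (real m * p / ((\<alpha> + 1) * F))) - (c1 + c2) * x ^ Suc m * (p / F) / (\<alpha> + 1))
      = \<alpha> * (real m + c1 + c2) * fps_nth (moment_series \<alpha> (\<lambda>k. x ^ k)) (Suc m)"
  proof -
    have "pochhammer \<alpha> (Suc m) = \<alpha> * p" by (simp add: p_def pochhammer_rec)
    hence "fps_nth (moment_series \<alpha> (\<lambda>k. x ^ k)) (Suc m) = - ((-1) ^ m * (\<alpha> * p) / (N * F)) * x ^ Suc m"
      unfolding moment_series_def fps_nth_Abs_fps gchoose_minus FN[symmetric] by simp
    then show ?thesis unfolding \<kappa>_def N_def[symmetric] using nz
      by (simp add: divide_simps power2_eq_square del: power_Suc) (simp add: algebra_simps del: power_Suc)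
  qed
  \<comment> \<open>lower powers from the first integral, matched with the coefficients of \<open>(1+z)\<^sup>\<alpha>\<^sup>+\<^sup>1\<close>\<close>
  have 2: "\<kappa> * (real (Suc m choose k) * (pochhammer (1 - \<alpha>) (m - 1 - k) * pochhammer (1 + \<alpha>) k / F) * x ^ Suc k)
     = ((\<alpha> + 1) gchoose (Suc m - k)) * real (Suc k) * fps_nth (moment_series \<alpha> (\<lambda>k. x ^ k)) (Suc k)"
    if k: "k < m" for k
  proof -
    define j where "j = m - 1 - k"
    have j: "Suc m - k = Suc (Suc j)" "m = Suc (k + j)" using k by (auto simp: j_def)
    have "real (Suc m choose k) = fact (Suc m) / (fact k * fact (Suc m - k))"
      using k by (intro binomial_fact) auto
    hence b: "real (Suc m choose k) = N * F / (fact k * fact (Suc (Suc j)))" unfolding FN j(1) .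
    have s: "(- 1) ^ m = (- (1::real)) * ((- 1) ^ k * (- 1) ^ j)" unfolding j(2) by (simp add: power_add)
    have fk: "fact (Suc k) = real (Suc k) * fact k" by simp
    have nz': "(fact (Suc (Suc j)) :: real) \<noteq> 0" "real (Suc k) \<noteq> 0" "(fact k::real) \<noteq> 0" by auto
    have g: "fps_nth (moment_series \<alpha> (\<lambda>k. x ^ k)) (Suc k)
      = - ((-1) ^ k * (\<alpha> * pochhammer (1 + \<alpha>) k) / (real (Suc k) * fact k)) * x ^ Suc k"
      unfolding moment_series_def fps_nth_Abs_fps gchoose_minus fk by (simp add: pochhammer_rec add.commute)
    show ?thesis
      unfolding g j(1) gchoose_plus_1_Suc_Suc b \<kappa>_def s j_def[symmetric] N_def[symmetric] using nz nz'
      by (simp add: divide_simps power2_eq_square del: power_Suc fact_Suc of_nat_Suc)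
  qed
  \<comment> \<open>lower powers from the second integral, matched with the coefficients of \<open>(1+z)\<^sup>\<alpha>\<close>\<close>
  have 3: "\<kappa> * (c1 / (\<alpha> + 1)) * (real (Suc m choose k) * (pochhammer (1 - \<alpha>) (m - k) * pochhammer \<alpha> k / F) * x ^ k)
     = \<alpha> * c1 * ((\<alpha> gchoose (Suc m - k)) * fps_nth (moment_series \<alpha> (\<lambda>k. x ^ k)) k)"
    if k: "k < Suc m" for k
  proof -
    define j where "j = m - k"
    have j: "Suc m - k = Suc j" "m = k + j" using k by (auto simp: j_def)
    have "real (Suc m choose k) = fact (Suc m) / (fact k * fact (Suc m - k))"
      using k by (intro binomial_fact) auto
    hence b: "real (Suc m choose k) = N * F / (fact k * fact (Suc j))" unfolding FN j(1) .
    have s: "(- 1) ^ m = ((- (1::real)) ^ k * (- 1) ^ j)" unfolding j(2) by (simp add: power_add)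
    have nz': "(fact (Suc j) :: real) \<noteq> 0" "(fact k::real) \<noteq> 0" by auto
    have g: "fps_nth (moment_series \<alpha> (\<lambda>k. x ^ k)) k = (-1) ^ k * pochhammer \<alpha> k / fact k * x ^ k"
      unfolding moment_series_def fps_nth_Abs_fps gchoose_minus ..
    show ?thesis
      unfolding g j(1) gchoose_Suc b \<kappa>_def s j_def[symmetric] N_def[symmetric] using nz nz'
      by (simp add: divide_simps power2_eq_square del: power_Suc fact_Suc of_nat_Suc)
  qed
  have "\<kappa> * A_op \<alpha> c1 c2 (\<lambda>x. x ^ Suc m) x
    = \<kappa> * (\<Sum>k<m. real (Suc m choose k) * (pochhammer (1 - \<alpha>) (m - 1 - k) * pochhammer (1 + \<alpha>) k / F) * x ^ Suc k)
     + \<kappa> * (- (x ^ Suc m * (real m * p / ((\<alpha> + 1) * F))) - (c1 + c2) * x ^ Suc m * (p / F) / (\<alpha> + 1))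
     + \<kappa> * (c1 / (\<alpha> + 1)) * (\<Sum>k<Suc m. real (Suc m choose k) * (pochhammer (1 - \<alpha>) (m - k) * pochhammer \<alpha> k / F) * x ^ k)"
    unfolding A_op_power[OF assms] F_def[symmetric] p_def[symmetric]
    by (simp add: algebra_simps diff_divide_distrib add_divide_distrib del: sum.lessThan_Suc power_Suc)
  also have "\<dots> = fps_nth (moment_ode \<alpha> c1 c2 (moment_series \<alpha> (\<lambda>k. x ^ k))) (Suc m)"
    unfolding moment_ode_nth lead sum_distrib_left using 2 3 by (simp del: sum.lessThan_Suc power_Suc)
  finally show ?thesis unfolding \<kappa>_def .
qed

section \<open>Stationarity in terms of moments\<close>

lemma integral_A_op_power:
  assumes "0 < \<alpha>" "\<alpha> < 1" "unit_law \<mu>"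
  shows "\<alpha>\<^sup>2 * (\<alpha> + 1) * (- 1) ^ m / real (Suc m) * (\<integral>x. A_op \<alpha> c1 c2 (\<lambda>x. x ^ Suc m) x \<partial>\<mu>) =
         fps_nth (moment_ode \<alpha> c1 c2 (moment_series \<alpha> (\<lambda>k. \<integral>x. x ^ k \<partial>\<mu>))) (Suc m)"
proof -
  have int: "integrable \<mu> (\<lambda>x. x ^ k)" for k
    by (rule C01_integrable[OF assms(3)]) (auto simp: C01_def intro!: continuous_intros)
  have "\<alpha>\<^sup>2 * (\<alpha> + 1) * (- 1) ^ m / real (Suc m) * (\<integral>x. A_op \<alpha> c1 c2 (\<lambda>x. x ^ Suc m) x \<partial>\<mu>)
    = (\<integral>x. fps_nth (moment_ode \<alpha> c1 c2 (moment_series \<alpha> (\<lambda>k. x ^ k))) (Suc m) \<partial>\<mu>)"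
    unfolding A_op_power_moment_ode[OF assms(1,2), symmetric] by (rule integral_mult_right_zero[symmetric])
  also have "\<dots> = fps_nth (moment_ode \<alpha> c1 c2 (moment_series \<alpha> (\<lambda>k. \<integral>x. x ^ k \<partial>\<mu>))) (Suc m)"
    unfolding moment_ode_nth moment_series_def fps_nth_Abs_fps
    by (intro has_bochner_integral_integral_eq has_bochner_integral_add has_bochner_integral_mult_right
      has_bochner_integral_sum has_bochner_integral_integrable int)
  finally show ?thesis .
qed

text \<open>
  In the recursion for the coefficients the leading factor \<open>\<alpha> (m + c\<^sub>1 + c\<^sub>2)\<close> does not vanish.
\<close>
lemma moment_ode_unique:
  assumes "\<alpha> > 0" "c1 > 0" "c2 > 0" "fps_nth F 0 = fps_nth G 0"
    "\<And>m. fps_nth (moment_ode \<alpha> c1 c2 F) (Suc m) = fps_nth (moment_ode \<alpha> c1 c2 G) (Suc m)"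
  shows "F = G"
proof (rule fps_ext)
  fix n show "fps_nth F n = fps_nth G n"
  proof (induction n rule: less_induct)
    case (less n)
    show ?case
    proof (cases n)
      case (Suc m)
      have "(\<Sum>k<m. ((\<alpha> + 1) gchoose (Suc m - k)) * real (Suc k) * fps_nth F (Suc k))
          = (\<Sum>k<m. ((\<alpha> + 1) gchoose (Suc m - k)) * real (Suc k) * fps_nth G (Suc k))"
        using less Suc by (intro sum.cong refl) auto
      moreover have "(\<Sum>k<Suc m. (\<alpha> gchoose (Suc m - k)) * fps_nth F k)
          = (\<Sum>k<Suc m. (\<alpha> gchoose (Suc m - k)) * fps_nth G k)"
        using less Suc by (intro sum.cong refl) auto
      ultimately have "\<alpha> * (real m + c1 + c2) * fps_nth F (Suc m) = \<alpha> * (real m + c1 + c2) * fps_nth G (Suc m)"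
        using assms(5)[of m] unfolding moment_ode_nth by simp
      moreover have "\<alpha> * (real m + c1 + c2) \<noteq> 0" using assms(1-3) by (simp add: add_eq_0_iff)
      ultimately show ?thesis using Suc by simp
    qed (use assms(4) in simp)
  qed
qed

lemma moment_series_inject:
  assumes "\<alpha> > 0" shows "moment_series \<alpha> f = moment_series \<alpha> g \<longleftrightarrow> f = g"
  using gchoose_minus_nonzero[OF assms] by (auto simp: moment_series_def fps_eq_iff)

lemma A_op_poly_C01:
  assumes "0 < \<alpha>" "\<alpha> < 1" shows "A_op \<alpha> c1 c2 (poly p) \<in> C01"
proof -
  have "continuous_on {0..1} (A_op \<alpha> c1 c2 (\<lambda>x. x ^ n))" for n
  proof (cases n)
    case 0 then show ?thesis by (simp add: A_op_def)
  next
    case (Suc m)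
    have "A_op \<alpha> c1 c2 (\<lambda>x. x ^ n) = (\<lambda>x.
     (\<Sum>k<m. real (Suc m choose k) * (pochhammer (1 - \<alpha>) (m - 1 - k) * pochhammer (1 + \<alpha>) k / fact m) * x ^ Suc k)
     - x ^ Suc m * (real m * pochhammer (\<alpha> + 1) m / ((\<alpha> + 1) * fact m))
     + (c1 * (\<Sum>k<Suc m. real (Suc m choose k) * (pochhammer (1 - \<alpha>) (m - k) * pochhammer \<alpha> k / fact m) * x ^ k)
         - (c1 + c2) * x ^ Suc m * (pochhammer (\<alpha> + 1) m / fact m)) / (\<alpha> + 1))"
      unfolding Suc by (rule ext, rule A_op_power[OF assms])
    then show ?thesis using assms by (auto intro!: continuous_intros simp del: sum.lessThan_Suc)
  qed
  then have "continuous_on {0..1} (\<lambda>x. \<Sum>n\<le>degree p. coeff p n * A_op \<alpha> c1 c2 (\<lambda>x. x ^ n) x)"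
    by (intro continuous_intros)
  moreover have "A_op \<alpha> c1 c2 (poly p) = (\<lambda>x. \<Sum>n\<le>degree p. coeff p n * A_op \<alpha> c1 c2 (\<lambda>x. x ^ n) x)"
    by (rule ext, rule A_op_poly[OF assms])
  ultimately show ?thesis unfolding C01_def by simp
qed

lemma poly_in_graph_closure:
  assumes "0 < \<alpha>" "\<alpha> < 1" shows "(poly p, A_op \<alpha> c1 c2 (poly p)) \<in> graph_closure (A_poly_graph \<alpha> c1 c2)"
proof -
  have "\<exists>F H. (\<forall>n::nat. (F n, H n) \<in> A_poly_graph \<alpha> c1 c2) \<and>
        uniform_limit {0..1} F (poly p) sequentially \<and> uniform_limit {0..1} H (A_op \<alpha> c1 c2 (poly p)) sequentially"
    by (rule exI[of _ "\<lambda>_. poly p"], rule exI[of _ "\<lambda>_. A_op \<alpha> c1 c2 (poly p)"])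
       (auto simp: A_poly_graph_def uniform_limit_const)
  then show ?thesis using C01_poly A_op_poly_C01[OF assms] unfolding graph_closure_def by simp
qed

text \<open>
  The process is only known through the closure of the operator on polynomials, so invariance means
  that the images of all polynomials have mean zero, and it suffices to test powers. These conditions say
  that the moment series solves the differential equation up to a constant.
\<close>
lemma stationary_iff_moment_ode:
  assumes a: "0 < \<alpha>" "\<alpha> < 1" and fs: "feller_semigroup T"
    and gen: "generator T = graph_closure (A_poly_graph \<alpha> c1 c2)" and ul: "unit_law \<mu>"
  shows "stationary_distribution T \<mu> \<longleftrightarrow>
    (\<forall>m. fps_nth (moment_ode \<alpha> c1 c2 (moment_series \<alpha> (\<lambda>k. \<integral>x. x ^ k \<partial>\<mu>))) (Suc m) = 0)"
proof -
  have pw: "poly (monom 1 n) = (\<lambda>x::real. x ^ n)" for n by (auto simp: poly_monom)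
  have nz: "\<alpha>\<^sup>2 * (\<alpha> + 1) * (- 1) ^ m / real (Suc m) \<noteq> 0" for m using a by auto
  have iff: "fps_nth (moment_ode \<alpha> c1 c2 (moment_series \<alpha> (\<lambda>k. \<integral>x. x ^ k \<partial>\<mu>))) (Suc m) = 0
    \<longleftrightarrow> (\<integral>x. A_op \<alpha> c1 c2 (\<lambda>x. x ^ Suc m) x \<partial>\<mu>) = 0" for m
    unfolding integral_A_op_power[OF a ul, symmetric] mult_eq_0_iff using nz[of m] by blast
  show ?thesis
  proof
    assume st: "stationary_distribution T \<mu>"
    have "(\<integral>x. A_op \<alpha> c1 c2 (\<lambda>x. x ^ Suc m) x \<partial>\<mu>) = 0" for m
      using stationary_imp_generator_null[OF fs st] poly_in_graph_closure[OF a, of "monom 1 (Suc m)" c1 c2]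
      unfolding gen pw by blast
    then show "\<forall>m. fps_nth (moment_ode \<alpha> c1 c2 (moment_series \<alpha> (\<lambda>k. \<integral>x. x ^ k \<partial>\<mu>))) (Suc m) = 0"
      unfolding iff by blast
  next
    assume "\<forall>m. fps_nth (moment_ode \<alpha> c1 c2 (moment_series \<alpha> (\<lambda>k. \<integral>x. x ^ k \<partial>\<mu>))) (Suc m) = 0"
    hence S: "(\<integral>x. A_op \<alpha> c1 c2 (\<lambda>x. x ^ Suc m) x \<partial>\<mu>) = 0" for m unfolding iff by blast
    have Z: "(\<integral>x. A_op \<alpha> c1 c2 (\<lambda>x. x ^ n) x \<partial>\<mu>) = 0" for n
    proof (cases n)
      case 0 then show ?thesis by (simp add: A_op_def)
    qed (use S in simp)
    have int: "integrable \<mu> (A_op \<alpha> c1 c2 (\<lambda>x. x ^ n))" for n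
      using C01_integrable[OF ul A_op_poly_C01[OF a, of c1 c2 "monom 1 n"]] unfolding pw .
    have P: "(\<integral>x. A_op \<alpha> c1 c2 (poly p) x \<partial>\<mu>) = 0" for p
      unfolding A_op_poly[OF a] by (simp add: Bochner_Integration.integral_sum int Z)
    show "stationary_distribution T \<mu>"
    proof (rule generator_null_imp_stationary[OF fs ul])
      fix f g assume "(f, g) \<in> generator T"
      then obtain F H where g: "g \<in> C01" and FH: "\<And>n::nat. (F n, H n) \<in> A_poly_graph \<alpha> c1 c2"
        and H: "uniform_limit {0..1} H g sequentially"
        unfolding gen graph_closure_def by auto
      have "\<exists>p. H n = A_op \<alpha> c1 c2 (poly p)" for n using FH[of n] unfolding A_poly_graph_def by auto
      hence HC: "\<And>n. H n \<in> C01" and H0: "\<And>n. (\<integral>x. H n x \<partial>\<mu>) = 0"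
        using A_op_poly_C01[OF a] P by metis+
      show "(\<integral>x. g x \<partial>\<mu>) = 0"
        using C01_integral_uniform_limit[OF ul HC g H] unfolding H0 by (simp add: LIMSEQ_const_iff)
    qed (use poly_in_graph_closure[OF a] gen in blast)
  qed
qed

lemma stationary_unique:
  assumes a: "0 < \<alpha>" "\<alpha> < 1" "0 < c1" "0 < c2" and fs: "feller_semigroup T"
    and gen: "generator T = graph_closure (A_poly_graph \<alpha> c1 c2)"
    and st: "stationary_distribution T \<mu>" "stationary_distribution T \<nu>"
  shows "\<mu> = \<nu>"
proof -
  have ul: "unit_law \<mu>" "unit_law \<nu>" using st unfolding stationary_distribution_def unit_law_def by blast+
  have one: "(\<integral>x. x ^ 0 \<partial>\<kappa>) = 1" if "unit_law \<kappa>" for \<kappa>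
    using that prob_space.prob_space unfolding unit_law_def by fastforce
  have "moment_series \<alpha> (\<lambda>k. \<integral>x. x ^ k \<partial>\<mu>) = moment_series \<alpha> (\<lambda>k. \<integral>x. x ^ k \<partial>\<nu>)"
  proof (rule moment_ode_unique[OF a(1,3,4)])
    show "fps_nth (moment_series \<alpha> (\<lambda>k. \<integral>x. x ^ k \<partial>\<mu>)) 0 = fps_nth (moment_series \<alpha> (\<lambda>k. \<integral>x. x ^ k \<partial>\<nu>)) 0"
      unfolding moment_series_def fps_nth_Abs_fps using one ul by simp
  qed (use stationary_iff_moment_ode[OF a(1,2) fs gen] ul st in simp)
  then have "(\<lambda>k. \<integral>x. x ^ k \<partial>\<mu>) = (\<lambda>k. \<integral>x. x ^ k \<partial>\<nu>)" using moment_series_inject[OF a(1)] by blast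
  then show ?thesis by (intro unit_law_eq_if_moments_eq ul) (rule fun_cong)
qed

section \<open>The hypergeometric solution of the moment equation\<close>

lemma fps_binomial_deriv_mult: "(1 + fps_X) * fps_deriv (fps_binomial a) = fps_const a * fps_binomial (a :: real)"
proof -
  have "fps_nth (1 + fps_X :: real fps) 0 \<noteq> 0" by simp
  then show ?thesis unfolding fps_binomial_deriv
    by (simp add: fps_divide_unit mult.commute[of "1 + fps_X"] mult.assoc inverse_mult_eq_1)
qed

text \<open>
  The hypergeometric series \<open>\<^sub>2F\<^sub>1(1, a; a + b; x)\<close>, which is the integral of \<open>1 / (1 - x y)\<close> over
  the beta law.
\<close>
definition beta_moment_series :: "real \<Rightarrow> real \<Rightarrow> real fps" where
  "beta_moment_series a b = Abs_fps (\<lambda>k. pochhammer a k / pochhammer (a + b) k)"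

text \<open>
  The contiguity relation \<open>(a + b + k) m\<^sub>k\<^sub>+\<^sub>1 = (a + k) m\<^sub>k\<close> between beta moments, as a differential
  equation.
\<close>
lemma beta_moment_series_ode:
  assumes "a > 0" "b > 0" defines "H \<equiv> beta_moment_series a b"
  shows "fps_X * (1 - fps_X) * fps_deriv H + (fps_const (a + b - 1) - fps_const a * fps_X) * H = fps_const (a + b - 1)"
proof (rule fps_ext)
  fix n
  have e: "fps_X * (1 - fps_X) * fps_deriv H + (fps_const (a + b - 1) - fps_const a * fps_X) * H
    = fps_X * (fps_deriv H - fps_X * fps_deriv H - fps_const a * H) + fps_const (a + b - 1) * H"
    by (simp add: algebra_simps)
  show "fps_nth (fps_X * (1 - fps_X) * fps_deriv H + (fps_const (a + b - 1) - fps_const a * fps_X) * H) n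
    = fps_nth (fps_const (a + b - 1)) n"
  proof (cases n)
    case 0 then show ?thesis unfolding e by (simp add: H_def beta_moment_series_def)
  next
    case (Suc k)
    have p: "pochhammer (a + b) k > 0" "a + b + real k > 0" using assms by (auto intro: pochhammer_pos)
    have H: "fps_nth H (Suc k) * (a + b + real k) = fps_nth H k * (a + real k)"
      using p by (simp add: H_def beta_moment_series_def pochhammer_Suc)
    have "fps_nth (fps_X * fps_deriv H) k = real k * fps_nth H k" by (cases k) auto
    then show ?thesis unfolding e Suc using H by (simp add: algebra_simps)
  qed
qed

text \<open>
  Substituting \<open>x = 1 - (1+z)\<^sup>\<alpha>\<close> in the hypergeometric equation; the chain rule brings in
  \<open>(1+z) (d/dz)(1+z)\<^sup>\<alpha> = \<alpha> (1+z)\<^sup>\<alpha>\<close>.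
\<close>
lemma moment_ode_compose_beta:
  assumes "c1 > 0" "c2 > 0"
  shows "moment_ode \<alpha> c1 c2 (beta_moment_series c1 c2 oo (1 - fps_binomial \<alpha>)) = fps_const (\<alpha> * (c1 + c2 - 1))"
proof -
  define H where "H = beta_moment_series c1 c2"
  define T where "T = fps_binomial \<alpha>"
  define U where "U = 1 - T"
  have U0: "fps_nth U 0 = 0" by (simp add: U_def T_def)
  have d: "fps_deriv U = - fps_deriv T" by (simp add: U_def)
  have T: "T = 1 - U" by (simp add: U_def)
  have "(fps_X * (1 - fps_X) * fps_deriv H + (fps_const (c1 + c2 - 1) - fps_const c1 * fps_X) * H) oo U = fps_const (c1 + c2 - 1)"
    using beta_moment_series_ode[OF assms] by (simp add: H_def)
  hence A: "U * (1 - U) * (fps_deriv H oo U) + (fps_const (c1 + c2 - 1) - fps_const c1 * U) * (H oo U) = fps_const (c1 + c2 - 1)"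
    by (simp add: fps_compose_add_distrib fps_compose_sub_distrib fps_compose_mult_distrib[OF U0] U0)
  have "moment_ode \<alpha> c1 c2 (H oo U) = U * (fps_deriv H oo U) * ((1 + fps_X) * fps_deriv T)
      + fps_const \<alpha> * (fps_const (c2 - 1) + fps_const c1 * T) * (H oo U)"
    unfolding moment_ode_def fps_compose_deriv[OF U0] d T_def[symmetric] by (simp add: U_def algebra_simps)
  also have "(1 + fps_X) * fps_deriv T = fps_const \<alpha> * T" unfolding T_def by (rule fps_binomial_deriv_mult)
  also have "U * (fps_deriv H oo U) * (fps_const \<alpha> * T) + fps_const \<alpha> * (fps_const (c2 - 1) + fps_const c1 * T) * (H oo U)
    = fps_const \<alpha> * (U * (1 - U) * (fps_deriv H oo U) + (fps_const (c2 - 1) + fps_const c1 - fps_const c1 * U) * (H oo U))"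
    unfolding T by (simp only: algebra_simps mult_1_right mult_1_left)
  also have "fps_const (c2 - 1) + fps_const c1 = fps_const (c1 + c2 - 1)" by (simp add: algebra_simps)
  also note A
  finally show ?thesis by (simp add: H_def U_def T_def)
qed

text \<open>
  Both sides invert \<open>1 - y U\<close>; the geometric series is a formal one because \<open>U\<close> has no constant term.
\<close>
lemma geometric_compose:
  assumes "fps_nth U 0 = 0" "M * (1 - fps_const (y::real) * U) = 1"
  shows "M = Abs_fps (\<lambda>k. y ^ k) oo U"
proof -
  have "Abs_fps (\<lambda>k. y ^ k) * (1 - fps_const y * fps_X) = 1"
  proof (rule fps_ext)
    fix n show "fps_nth (Abs_fps (\<lambda>k. y ^ k) * (1 - fps_const y * fps_X)) n = fps_nth 1 n"
      by (cases n) (simp_all add: algebra_simps)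
  qed
  hence "(Abs_fps (\<lambda>k. y ^ k) * (1 - fps_const y * fps_X)) oo U = 1" by simp
  hence 1: "(Abs_fps (\<lambda>k. y ^ k) oo U) * (1 - fps_const y * U) = 1"
    using assms(1) by (simp add: fps_compose_sub_distrib fps_compose_mult_distrib[OF assms(1)])
  have "(Abs_fps (\<lambda>k. y ^ k) oo U) = (Abs_fps (\<lambda>k. y ^ k) oo U) * (M * (1 - fps_const y * U))"
    using assms(2) by simp
  also have "\<dots> = M" using 1 by (simp add: mult_ac)
  finally show ?thesis by simp
qed

section \<open>Negative moments of stable pairs\<close>

text \<open>
  The integral \<open>\<integral> l\<^sup>\<alpha>\<^sup>-\<^sup>1 e\<^sup>-\<^sup>l\<^sup>w dl\<close>, which is \<open>\<Gamma>(\<alpha>) w\<^sup>-\<^sup>\<alpha>\<close> for \<open>w > 0\<close>. Taking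
  values in \<open>ennreal\<close> records that it diverges at \<open>w = 0\<close>, whereas \<open>0 powr (- \<alpha>) = 0\<close>; this is what
  detects that a stable pair has a positive sum.
\<close>
definition laplace_power :: "real \<Rightarrow> real \<Rightarrow> ennreal" where
  "laplace_power \<alpha> w = (\<integral>\<^sup>+l. ennreal (indicator {0<..} l * l powr (\<alpha> - 1) * exp (- l * w)) \<partial>lborel)"

lemma laplace_power_pos:
  assumes "\<alpha> > 0" "w > 0"
  shows "laplace_power \<alpha> w = ennreal (Gamma \<alpha> * w powr (- \<alpha>))"
proof -
  define g where "g = (\<lambda>t::real. indicator {0<..} t * t powr (\<alpha> - 1) * exp (- t))"
  have [measurable]: "g \<in> borel_measurable borel" unfolding g_def by measurable
  have "(g has_integral Gamma \<alpha>) UNIV"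
  proof -
    have "((\<lambda>t. if t \<in> {0..} then t powr (\<alpha> - 1) / exp t else 0) has_integral Gamma \<alpha>) UNIV"
      using Gamma_integral_real[OF assms(1)] by (simp only: has_integral_restrict_UNIV)
    then show ?thesis
      by (rule has_integral_eq[rotated]) (auto simp: g_def exp_minus field_simps indicator_def)
  qed
  hence G: "(\<integral>\<^sup>+t. ennreal (g t) \<partial>lborel) = ennreal (Gamma \<alpha>)"
    by (intro nn_integral_has_integral_lborel) (auto simp: g_def)
  have "(\<integral>\<^sup>+t. ennreal (g t) \<partial>lborel) = ennreal w * (\<integral>\<^sup>+t. ennreal (g (0 + w * t)) \<partial>lborel)"
    using assms by (subst nn_integral_real_affine[of _ w 0]) auto
  also have "\<dots> = (\<integral>\<^sup>+t. ennreal w * ennreal (g (w * t)) \<partial>lborel)"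
    by (subst nn_integral_cmult) auto
  also have "\<dots> = (\<integral>\<^sup>+t. ennreal (w powr \<alpha>) * ennreal (indicator {0<..} t * t powr (\<alpha> - 1) * exp (- t * w)) \<partial>lborel)"
  proof (intro nn_integral_cong)
    fix t :: real
    have "w * g (w * t) = w powr \<alpha> * (indicator {0<..} t * t powr (\<alpha> - 1) * exp (- t * w))"
    proof (cases "t > 0")
      case True
      then have "w * (w * t) powr (\<alpha> - 1) = w powr \<alpha> * t powr (\<alpha> - 1)"
        using assms by (simp add: powr_mult powr_diff)
      then show ?thesis using True assms by (simp add: g_def mult.commute)
    qed (use assms in \<open>simp add: g_def zero_less_mult_iff\<close>)
    then show "ennreal w * ennreal (g (w * t)) = ennreal (w powr \<alpha>) * ennreal (indicator {0<..} t * t powr (\<alpha> - 1) * exp (- t * w))"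
      using assms by (simp flip: ennreal_mult')
  qed
  also have "\<dots> = ennreal (w powr \<alpha>) * laplace_power \<alpha> w"
    unfolding laplace_power_def by (rule nn_integral_cmult) measurable
  finally have e: "ennreal (Gamma \<alpha>) = ennreal (w powr \<alpha>) * laplace_power \<alpha> w" unfolding G .
  have "laplace_power \<alpha> w = ennreal (w powr (- \<alpha>)) * (ennreal (w powr \<alpha>) * laplace_power \<alpha> w)"
    using assms by (simp add: mult.assoc[symmetric] ennreal_mult'[symmetric] powr_add[symmetric])
  also have "\<dots> = ennreal (Gamma \<alpha> * w powr (- \<alpha>))"
    unfolding e[symmetric] using assms by (simp add: ennreal_mult' mult.commute)
  finally show ?thesis .
qed

text \<open>
  The integral at \<open>0\<close> dominates the one at every \<open>w > 0\<close>, and these are unbounded.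
\<close>
lemma laplace_power_0:
  assumes "\<alpha> > 0" shows "laplace_power \<alpha> 0 = \<infinity>"
proof (rule ccontr)
  assume "laplace_power \<alpha> 0 \<noteq> \<infinity>"
  then obtain r where r: "r \<ge> 0" "laplace_power \<alpha> 0 = ennreal r"
    by (cases "laplace_power \<alpha> 0") auto
  have G: "Gamma \<alpha> > 0" using assms by (rule Gamma_real_pos)
  \<comment> \<open>the point where \<open>\<Gamma>(\<alpha>) w\<^sup>-\<^sup>\<alpha> = r + 1\<close>\<close>
  define w where "w = ((r + 1) / Gamma \<alpha>) powr (- 1 / \<alpha>)"
  have w: "w > 0" using r G by (simp add: w_def)
  have "w powr (- \<alpha>) = (r + 1) / Gamma \<alpha>" using r G assms by (simp add: w_def powr_powr)
  hence "ennreal (r + 1) = laplace_power \<alpha> w" using laplace_power_pos[OF assms w] G by simp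
  also have "\<dots> \<le> laplace_power \<alpha> 0" unfolding laplace_power_def
    using w by (intro nn_integral_mono ennreal_leI) (auto simp: indicator_def intro!: mult_left_le)
  finally show False using r by (simp add: r(2))
qed

text \<open>
  The integrand is, up to a constant, the derivative of \<open>exp (- A l\<^sup>\<alpha>)\<close>.
\<close>
lemma nn_integral_weibull:
  assumes "\<alpha> > 0" "A > 0"
  shows "(\<integral>\<^sup>+l. ennreal (indicator {0<..} l * l powr (\<alpha> - 1) * exp (- A * l powr \<alpha>)) \<partial>lborel) = ennreal (1 / (\<alpha> * A))"
proof -
  define f where "f = (\<lambda>l::real. l powr (\<alpha> - 1) * exp (- A * l powr \<alpha>))"
  define F where "F = (\<lambda>l::real. - exp (- A * l powr \<alpha>) / (\<alpha> * A))"
  have D: "DERIV F x :> f x" if "0 < ereal x" "ereal x < \<infinity>" for x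
    unfolding F_def f_def using that assms by (auto intro!: derivative_eq_intros simp: powr_diff field_simps)
  have C: "isCont f x" if "0 < ereal x" "ereal x < \<infinity>" for x
    unfolding f_def using that by (auto intro!: continuous_intros)
  have "(F \<longlongrightarrow> - exp (- A * 0) / (\<alpha> * A)) (at_right 0)"
    unfolding F_def using assms
    by (intro tendsto_intros tendsto_zero_powrI[where b = \<alpha>]) (auto intro!: eventually_at_right_less tendsto_eq_intros simp: eventually_at_filter)
  hence A: "((F \<circ> real_of_ereal) \<longlongrightarrow> - 1 / (\<alpha> * A)) (at_right 0)"
    by (simp add: zero_ereal_def ereal_tendsto_simps)
  have "(F \<longlongrightarrow> - 0 / (\<alpha> * A)) at_top"
    unfolding F_def
  proof (intro tendsto_intros)
    have "filterlim (\<lambda>x::real. exp (\<alpha> * ln x)) at_top at_top"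
      using assms by (intro filterlim_compose[OF exp_at_top] filterlim_tendsto_pos_mult_at_top[OF tendsto_const] ln_at_top) auto
    hence "filterlim (\<lambda>x::real. x powr \<alpha>) at_top at_top"
      by (rule filterlim_mono_eventually[OF _ order_refl order_refl])
         (auto intro: eventually_mono[OF eventually_gt_at_top[of 0]] simp: powr_def)
    hence "filterlim (\<lambda>x::real. - A * x powr \<alpha>) at_bot at_top"
      using assms by (intro filterlim_tendsto_neg_mult_at_bot[OF tendsto_const]) auto
    then show "((\<lambda>x. exp (- A * x powr \<alpha>)) \<longlongrightarrow> 0) at_top" by (rule filterlim_compose[OF exp_at_bot])
  qed (use assms in auto)
  hence B: "((F \<circ> real_of_ereal) \<longlongrightarrow> 0) (at_left \<infinity>)" by (simp add: ereal_tendsto_simps)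
  have nn: "AE x in lborel. 0 < ereal x \<longrightarrow> ereal x < \<infinity> \<longrightarrow> 0 \<le> f x" by (auto simp: f_def)
  have e: "einterval 0 \<infinity> = {0<..}" by (auto simp: einterval_def)
  have i: "set_integrable lborel {0<..} f"
    using interval_integral_FTC_nonneg(1)[OF _ D C nn A B] unfolding e by simp
  have "(LBINT x=0..\<infinity>. f x) = 0 - (- 1 / (\<alpha> * A))"
    using interval_integral_FTC_nonneg(2)[OF _ D C nn A B] by simp
  hence v: "(LINT x|lborel. indicator {0<..} x *\<^sub>R f x) = 1 / (\<alpha> * A)"
    unfolding interval_lebesgue_integral_def e set_lebesgue_integral_def by simp
  have "(\<integral>\<^sup>+l. ennreal (indicator {0<..} l *\<^sub>R f l) \<partial>lborel) = ennreal (1 / (\<alpha> * A))"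
    unfolding v[symmetric] using i unfolding set_integrable_def
    by (intro nn_integral_eq_integral) (auto simp: f_def)
  then show ?thesis by (simp add: f_def mult.assoc)
qed

lemma stable_pair_law_sets: "stable_pair_law \<alpha> y M \<Longrightarrow> sets M = sets (borel \<Otimes>\<^sub>M borel)"
  unfolding stable_pair_law_def borel_prod by blast

text \<open>
  Exchanging the integrals turns the inner one into the Laplace transform on the ray through \<open>(s, 1)\<close>,
  where it equals \<open>exp (- (y s\<^sup>\<alpha> + 1 - y) l\<^sup>\<alpha>)\<close>.
\<close>
lemma stable_pair_laplace_power:
  assumes a: "0 < \<alpha>" "\<alpha> < 1" and y: "0 < y" "y < 1" and st: "stable_pair_law \<alpha> y M" and s: "s > 0"
  shows "(\<integral>\<^sup>+p. laplace_power \<alpha> (s * fst p + snd p) \<partial>M) = ennreal (1 / (\<alpha> * (y * s powr \<alpha> + (1 - y))))"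
proof -
  interpret prob_space M using st unfolding stable_pair_law_def by blast
  have sets[measurable_cong]: "sets M = sets (borel \<Otimes>\<^sub>M borel)" by (rule stable_pair_law_sets[OF st])
  define A where "A = y * s powr \<alpha> + (1 - y)"
  have A: "A > 0" using y s by (simp add: A_def add_pos_pos)
  interpret lb: pair_sigma_finite lborel M ..
  have L: "(\<integral>\<^sup>+p. ennreal (exp (- l * (s * fst p + snd p))) \<partial>M) = ennreal (exp (- A * l powr \<alpha>))" if l: "l > 0" for l
  proof -
    have "(\<integral>(Y1, Y2). exp (- (l * s) * Y1 - l * Y2) \<partial>M) = exp (- y * (l * s) powr \<alpha> - (1 - y) * l powr \<alpha>)"
      using st l s unfolding stable_pair_law_def by simp
    also have "\<dots> = exp (- A * l powr \<alpha>)" using l s by (simp add: A_def powr_mult algebra_simps)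
    also have "(\<integral>(Y1, Y2). exp (- (l * s) * Y1 - l * Y2) \<partial>M) = (\<integral>p. exp (- l * (s * fst p + snd p)) \<partial>M)"
      by (rule Bochner_Integration.integral_cong[OF refl]) (simp add: case_prod_beta' algebra_simps)
    finally have e: "(\<integral>p. exp (- l * (s * fst p + snd p)) \<partial>M) = exp (- A * l powr \<alpha>)" .
    have "integrable M (\<lambda>p. exp (- l * (s * fst p + snd p)))"
      using e not_integrable_integral_eq by (metis exp_not_eq_zero)
    then show ?thesis unfolding e[symmetric] by (rule nn_integral_eq_integral) simp
  qed
  have "(\<integral>\<^sup>+p. laplace_power \<alpha> (s * fst p + snd p) \<partial>M)
     = (\<integral>\<^sup>+l. (\<integral>\<^sup>+p. ennreal (indicator {0<..} l * l powr (\<alpha> - 1) * exp (- l * (s * fst p + snd p))) \<partial>M) \<partial>lborel)"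
    unfolding laplace_power_def
    by (rule lb.Fubini') measurable
  also have "\<dots> = (\<integral>\<^sup>+l. ennreal (indicator {0<..} l * l powr (\<alpha> - 1) * exp (- A * l powr \<alpha>)) \<partial>lborel)"
  proof (intro nn_integral_cong)
    fix l :: real
    have "(\<integral>\<^sup>+p. ennreal (indicator {0<..} l * l powr (\<alpha> - 1) * exp (- l * (s * fst p + snd p))) \<partial>M)
      = ennreal (indicator {0<..} l * l powr (\<alpha> - 1)) * (\<integral>\<^sup>+p. ennreal (exp (- l * (s * fst p + snd p))) \<partial>M)"
      by (subst nn_integral_cmult[symmetric]) (auto simp: ennreal_mult)
    also have "\<dots> = ennreal (indicator {0<..} l * l powr (\<alpha> - 1) * exp (- A * l powr \<alpha>))"
      using L[of l] by (cases "l > 0") (auto simp: ennreal_mult)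
    finally show "(\<integral>\<^sup>+p. ennreal (indicator {0<..} l * l powr (\<alpha> - 1) * exp (- l * (s * fst p + snd p))) \<partial>M)
      = ennreal (indicator {0<..} l * l powr (\<alpha> - 1) * exp (- A * l powr \<alpha>))" .
  qed
  also have "\<dots> = ennreal (1 / (\<alpha> * A))" by (rule nn_integral_weibull[OF a(1) A])
  finally show ?thesis unfolding A_def .
qed

lemma borel_measurable_laplace_power [measurable]: "laplace_power \<alpha> \<in> borel_measurable borel"
  unfolding laplace_power_def[abs_def] by measurable

text \<open>
  A sum equal to \<open>0\<close> on an event of positive probability would make the expectation just computed
  infinite.
\<close>
lemma stable_pair_sum_pos:
  assumes a: "0 < \<alpha>" "\<alpha> < 1" and y: "0 < y" "y < 1" and st: "stable_pair_law \<alpha> y M"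
  shows "AE p in M. 0 \<le> fst p \<and> 0 \<le> snd p \<and> 0 < fst p + snd p"
proof -
  have sets[measurable_cong]: "sets M = sets (borel \<Otimes>\<^sub>M borel)" by (rule stable_pair_law_sets[OF st])
  have nonneg: "AE p in M. 0 \<le> fst p \<and> 0 \<le> snd p" using st unfolding stable_pair_law_def by (simp add: case_prod_beta')
  have "(\<integral>\<^sup>+p. laplace_power \<alpha> (1 * fst p + snd p) \<partial>M) \<noteq> \<infinity>"
    using stable_pair_laplace_power[OF assms, of 1] by simp
  hence "AE p in M. laplace_power \<alpha> (1 * fst p + snd p) \<noteq> \<infinity>"
    by (intro nn_integral_PInf_AE) measurable
  with nonneg show ?thesis
  proof eventually_elim
    case (elim p)
    then have "fst p + snd p \<noteq> 0" using laplace_power_0[OF a(1)] by auto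
    with elim show ?case by simp
  qed
qed

lemma stable_pair_negative_moment:
  assumes a: "0 < \<alpha>" "\<alpha> < 1" and y: "0 < y" "y < 1" and st: "stable_pair_law \<alpha> y M" and s: "s > 0"
  shows "(\<integral>\<^sup>+p. ennreal (Gamma (\<alpha> + 1) * (s * fst p + snd p) powr (- \<alpha>)) \<partial>M) = ennreal (1 / (y * s powr \<alpha> + (1 - y)))"
proof -
  have sets[measurable_cong]: "sets M = sets (borel \<Otimes>\<^sub>M borel)" by (rule stable_pair_law_sets[OF st])
  have G: "Gamma (\<alpha> + 1) = \<alpha> * Gamma \<alpha>" 
  proof -
    have "\<alpha> \<notin> \<int>\<^sub>\<le>\<^sub>0" using a by auto
    then show ?thesis by (rule Gamma_plus1)
  qed
  have G0: "Gamma \<alpha> > 0" using a by (intro Gamma_real_pos)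
  have A: "y * s powr \<alpha> + (1 - y) > 0" using y s by (simp add: add_pos_pos)
  have "(\<integral>\<^sup>+p. ennreal (Gamma (\<alpha> + 1) * (s * fst p + snd p) powr (- \<alpha>)) \<partial>M)
    = (\<integral>\<^sup>+p. ennreal \<alpha> * laplace_power \<alpha> (s * fst p + snd p) \<partial>M)"
  proof (intro nn_integral_cong_AE)
    show "AE p in M. ennreal (Gamma (\<alpha> + 1) * (s * fst p + snd p) powr (- \<alpha>)) = ennreal \<alpha> * laplace_power \<alpha> (s * fst p + snd p)"
      using stable_pair_sum_pos[OF a y st]
    proof eventually_elim
      case (elim p)
      have "s * fst p + snd p > 0"
        using elim s by (cases "fst p = 0") (auto intro: add_pos_nonneg)
      then show ?case using a G0 by (simp add: laplace_power_pos G ennreal_mult'[symmetric] mult.assoc)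
    qed
  qed
  also have "\<dots> = ennreal \<alpha> * ennreal (1 / (\<alpha> * (y * s powr \<alpha> + (1 - y))))"
    unfolding stable_pair_laplace_power[OF assms, symmetric] by (rule nn_integral_cmult) measurable
  also have "\<dots> = ennreal (1 / (y * s powr \<alpha> + (1 - y)))"
    using a by (simp add: ennreal_mult'[symmetric])
  finally show ?thesis .
qed

section \<open>The law of the ratio of a stable pair\<close>

text \<open>
  Clamping makes the ratio a map into the unit interval on the whole plane, so that its law lives on
  \<open>[0,1]\<close>; almost surely under a stable pair it is the ratio itself.
\<close>
definition clamp_ratio :: "real \<times> real \<Rightarrow> real" where
  "clamp_ratio p = max 0 (min 1 (fst p / (fst p + snd p)))"

definition ratio_law :: "real \<Rightarrow> (real \<times> real) measure \<Rightarrow> real measure" where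
  "ratio_law \<alpha> M = distr (density M (\<lambda>p. ennreal (Gamma (\<alpha> + 1) * (fst p + snd p) powr (- \<alpha>)))) unit_borel clamp_ratio"

lemma clamp_ratio_eq: "0 \<le> fst p \<Longrightarrow> 0 \<le> snd p \<Longrightarrow> 0 < fst p + snd p \<Longrightarrow> clamp_ratio p = fst p / (fst p + snd p)"
  unfolding clamp_ratio_def by (simp add: min_def max_def divide_simps)

lemma measurable_clamp_ratio [measurable]: "clamp_ratio \<in> (borel \<Otimes>\<^sub>M borel) \<rightarrow>\<^sub>M unit_borel"
  unfolding clamp_ratio_def[abs_def] by (rule measurable_restrict_space2) (auto simp: max_def min_def)

lemma nn_integral_ratio_law:
  assumes st: "stable_pair_law \<alpha> y M" and f[measurable]: "f \<in> borel_measurable unit_borel"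
  shows "(\<integral>\<^sup>+x. f x \<partial>ratio_law \<alpha> M) = (\<integral>\<^sup>+p. ennreal (Gamma (\<alpha> + 1) * (fst p + snd p) powr (- \<alpha>)) * f (clamp_ratio p) \<partial>M)"
proof -
  have sets[measurable_cong]: "sets M = sets (borel \<Otimes>\<^sub>M borel)" by (rule stable_pair_law_sets[OF st])
  have [measurable]: "clamp_ratio \<in> M \<rightarrow>\<^sub>M unit_borel" by measurable
  show ?thesis unfolding ratio_law_def
    by (subst nn_integral_distr, measurable) (subst nn_integral_density, auto)
qed

text \<open>
  Since \<open>(Y\<^sub>1 + Y\<^sub>2) (1 + z Y\<^sub>1 / (Y\<^sub>1 + Y\<^sub>2)) = (1 + z) Y\<^sub>1 + Y\<^sub>2\<close>, the weight \<open>(Y\<^sub>1 + Y\<^sub>2)\<^sup>-\<^sup>\<alpha>\<close> is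
  just what is needed to make the left-hand side a negative moment of a linear form.
\<close>
lemma ratio_law_transform_nn:
  assumes a: "0 < \<alpha>" "\<alpha> < 1" and y: "0 < y" "y < 1" and st: "stable_pair_law \<alpha> y M" and z: "\<bar>z\<bar> < 1"
  shows "(\<integral>\<^sup>+x. ennreal ((1 + z * x) powr (- \<alpha>)) \<partial>ratio_law \<alpha> M) = ennreal (1 / (y * (1 + z) powr \<alpha> + (1 - y)))"
proof -
  have [measurable]: "(\<lambda>x::real. x) \<in> borel_measurable unit_borel"
    by (intro measurable_restrict_space1) simp
  have G0: "Gamma (\<alpha> + 1) > 0" using a by (intro Gamma_real_pos) simp
  have "(\<integral>\<^sup>+x. ennreal ((1 + z * x) powr (- \<alpha>)) \<partial>ratio_law \<alpha> M)
    = (\<integral>\<^sup>+p. ennreal (Gamma (\<alpha> + 1) * (fst p + snd p) powr (- \<alpha>)) * ennreal ((1 + z * clamp_ratio p) powr (- \<alpha>)) \<partial>M)"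
    by (rule nn_integral_ratio_law[OF st]) measurable
  also have "\<dots> = (\<integral>\<^sup>+p. ennreal (Gamma (\<alpha> + 1) * ((1 + z) * fst p + snd p) powr (- \<alpha>)) \<partial>M)"
  proof (intro nn_integral_cong_AE)
    show "AE p in M. ennreal (Gamma (\<alpha> + 1) * (fst p + snd p) powr (- \<alpha>)) * ennreal ((1 + z * clamp_ratio p) powr (- \<alpha>))
       = ennreal (Gamma (\<alpha> + 1) * ((1 + z) * fst p + snd p) powr (- \<alpha>))"
      using stable_pair_sum_pos[OF a y st]
    proof eventually_elim
      case (elim p)
      define x where "x = fst p / (fst p + snd p)"
      have x: "0 \<le> x" "x \<le> 1" using elim by (auto simp: x_def divide_simps)
      have "\<bar>z * x\<bar> < 1"
      proof -
        have "\<bar>z\<bar> * \<bar>x\<bar> \<le> \<bar>z\<bar> * 1" using x by (intro mult_left_mono) auto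
        then show ?thesis using z by (simp add: abs_mult)
      qed
      hence pos: "1 + z * x > 0" by linarith
      have "(fst p + snd p) * (1 + z * x) = (1 + z) * fst p + snd p" using elim by (simp add: x_def field_simps)
      hence "((1 + z) * fst p + snd p) powr (- \<alpha>) = (fst p + snd p) powr (- \<alpha>) * (1 + z * x) powr (- \<alpha>)"
        using elim pos by (metis powr_mult less_imp_le)
      then show ?case using G0 clamp_ratio_eq[of p, folded x_def] elim by (simp add: ennreal_mult'[symmetric] mult.assoc)
    qed
  qed
  also have "\<dots> = ennreal (1 / (y * (1 + z) powr \<alpha> + (1 - y)))"
    using z by (intro stable_pair_negative_moment[OF a y st]) auto
  finally show ?thesis .
qed

text \<open>
  The total mass is the transform at \<open>z = 0\<close>.
\<close>
lemma unit_law_ratio_law: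
  assumes a: "0 < \<alpha>" "\<alpha> < 1" and y: "0 < y" "y < 1" and st: "stable_pair_law \<alpha> y M"
  shows "unit_law (ratio_law \<alpha> M)"
proof -
  have "emeasure (ratio_law \<alpha> M) (space (ratio_law \<alpha> M)) = (\<integral>\<^sup>+x. ennreal ((1 + 0 * x) powr (- \<alpha>)) \<partial>ratio_law \<alpha> M)"
    by simp
  also have "\<dots> = ennreal (1 / (y * (1 + 0) powr \<alpha> + (1 - y)))" by (rule ratio_law_transform_nn[OF assms]) simp
  finally have "prob_space (ratio_law \<alpha> M)" by (intro prob_spaceI) simp
  then show ?thesis by (simp add: unit_law_def ratio_law_def)
qed

lemma abs_gchoose_le_1:
  assumes "0 < \<alpha>" "\<alpha> < 1" shows "\<bar>((- \<alpha>) gchoose n)\<bar> \<le> (1::real)"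
proof -
  have "0 \<le> pochhammer \<alpha> n \<and> pochhammer \<alpha> n \<le> fact n"
  proof (induction n)
    case (Suc n)
    have "pochhammer \<alpha> n * (\<alpha> + real n) \<le> fact n * (1 + real n)"
      using Suc assms by (intro mult_mono) auto
    then show ?case using Suc assms by (simp add: pochhammer_Suc algebra_simps)
  qed simp
  then show ?thesis by (simp add: gchoose_minus abs_mult power_abs divide_simps)
qed

text \<open>
  The binomial series is integrated term by term; its coefficients are bounded by \<open>1\<close>, so a
  geometric series dominates.
\<close>
lemma moment_series_sums:
  assumes a: "0 < \<alpha>" "\<alpha> < 1" and ul: "unit_law \<mu>" and z: "\<bar>z\<bar> < 1"
  shows "(\<lambda>n. fps_nth (moment_series \<alpha> (\<lambda>k. \<integral>x. x ^ k \<partial>\<mu>)) n * z ^ n) sums (\<integral>x. (1 + z * x) powr (- \<alpha>) \<partial>\<mu>)"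
proof -
  have int: "integrable \<mu> (\<lambda>x. x ^ k)" for k
    by (rule C01_integrable[OF ul]) (auto simp: C01_def intro!: continuous_intros)
  have sp: "space \<mu> = {0..1}" by (rule unit_law_space[OF ul])
  have zx: "\<bar>z * x\<bar> < 1" if "x \<in> {0..1}" for x
  proof -
    have "\<bar>z\<bar> * \<bar>x\<bar> \<le> \<bar>z\<bar> * 1" using that by (intro mult_left_mono) auto
    then show ?thesis using z by (simp add: abs_mult)
  qed
  define f where "f = (\<lambda>n x. ((- \<alpha>) gchoose n) * (z * x) ^ n)"
  have fint: "integrable \<mu> (f n)" for n
    unfolding f_def power_mult_distrib by (intro integrable_mult_right int)
  have geo: "summable (\<lambda>n. \<bar>z\<bar> ^ n)" using z by (intro summable_geometric) simp
  have nb: "norm (f n x) \<le> \<bar>z\<bar> ^ n" if "x \<in> {0..1}" for n x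
  proof -
    have "\<bar>x\<bar> ^ n \<le> 1" using that by (simp add: power_le_one)
    hence "\<bar>z\<bar> ^ n * \<bar>x\<bar> ^ n \<le> \<bar>z\<bar> ^ n * 1" by (intro mult_left_mono) auto
    hence "\<bar>(- \<alpha>) gchoose n\<bar> * (\<bar>z\<bar> ^ n * \<bar>x\<bar> ^ n) \<le> 1 * \<bar>z\<bar> ^ n"
      using abs_gchoose_le_1[OF a, of n] by (intro mult_mono) auto
    then show ?thesis by (simp add: f_def abs_mult power_abs power_mult_distrib)
  qed
  have s: "(\<lambda>n. f n x) sums (1 + z * x) powr (- \<alpha>)" if "x \<in> {0..1}" for x
    unfolding f_def using gen_binomial_real[OF zx[OF that]] .
  have "(\<lambda>n. \<integral>x. f n x \<partial>\<mu>) sums (\<integral>x. (\<Sum>n. f n x) \<partial>\<mu>)"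
  proof (rule sums_integral[OF fint])
    show "AE x in \<mu>. summable (\<lambda>i. norm (f i x))"
      using nb sp by (intro AE_I2 summable_comparison_test'[OF geo]) auto
    interpret prob_space \<mu> using ul unfolding unit_law_def by blast
    have "(\<integral>x. norm (f n x) \<partial>\<mu>) \<le> \<bar>z\<bar> ^ n" for n
      using nb sp by (intro integral_le_const integrable_norm fint AE_I2) auto
    then show "summable (\<lambda>i. \<integral>x. norm (f i x) \<partial>\<mu>)"
      by (intro summable_comparison_test'[OF geo]) auto
  qed
  also have "(\<integral>x. (\<Sum>n. f n x) \<partial>\<mu>) = (\<integral>x. (1 + z * x) powr (- \<alpha>) \<partial>\<mu>)"
    by (rule C01_integral_cong[OF ul]) (rule sums_unique[symmetric, OF s])
  also have "(\<lambda>n. \<integral>x. f n x \<partial>\<mu>) = (\<lambda>n. fps_nth (moment_series \<alpha> (\<lambda>k. \<integral>x. x ^ k \<partial>\<mu>)) n * z ^ n)"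
    by (simp add: f_def moment_series_def power_mult_distrib mult_ac)
  finally show ?thesis .
qed

text \<open>
  Otherwise divide by the leading power of \<open>z\<close>: the quotient vanishes off \<open>0\<close>, but its value at \<open>0\<close>
  is the leading coefficient.
\<close>
lemma fps_eq_0_if_eval_eq_0:
  fixes F :: "real fps"
  assumes r: "r > 0" "ereal r \<le> fps_conv_radius F" and z: "\<And>z. \<bar>z\<bar> < r \<Longrightarrow> eval_fps F z = 0"
  shows "F = 0"
proof (rule ccontr)
  assume F: "F \<noteq> 0"
  define G where "G = fps_shift (subdegree F) F"
  have G0: "fps_nth G 0 \<noteq> 0" using F by (simp add: G_def)
  have cr: "fps_conv_radius G = fps_conv_radius F" by (simp add: G_def)
  have "isCont (eval_fps G) 0"
    using r by (intro continuous_eval_fps) (auto simp: cr zero_ereal_def[symmetric] intro: less_le_trans[of 0 "ereal r"])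
  hence "(eval_fps G \<longlongrightarrow> eval_fps G 0) (at 0)" by (simp add: isCont_def)
  moreover have "\<forall>\<^sub>F z in at 0. eval_fps G z = 0"
  proof -
    have "\<forall>\<^sub>F z in at (0::real). z \<in> ball 0 r - {0}"
      using r by (intro eventually_at_in_open) auto
    then show ?thesis
    proof eventually_elim
      case (elim z)
      hence "z \<noteq> 0" "\<bar>z\<bar> < r" by auto
      moreover have "ereal (norm z) < fps_conv_radius F" using elim r by (auto intro: less_le_trans[of _ "ereal r"])
      ultimately show ?case unfolding G_def using z[of z] by (subst eval_fps_shift) auto
    qed
  qed
  hence "(eval_fps G \<longlongrightarrow> 0) (at 0)" by (rule tendsto_eventually)
  ultimately have "eval_fps G 0 = 0" using tendsto_unique by (metis trivial_limit_at)
  then show False using G0 by (simp add: eval_fps_at_0)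
qed

lemma fps_conv_radius_ge_1:
  fixes F :: "real fps"
  assumes "\<And>z. \<bar>z\<bar> < 1 \<Longrightarrow> summable (\<lambda>n. fps_nth F n * z ^ n)" shows "fps_conv_radius F \<ge> 1"
  unfolding fps_conv_radius_def one_ereal_def
  by (rule conv_radius_geI_ex') (use assms in auto)

text \<open>
  The transform is \<open>1 / (1 - y (1 - (1+z)\<^sup>\<alpha>))\<close> for \<open>\<bar>z\<bar> < 1\<close>, and a power series is determined by its
  values near \<open>0\<close>. In particular each moment is a polynomial in \<open>y\<close>.
\<close>
lemma ratio_law_moment_series:
  assumes a: "0 < \<alpha>" "\<alpha> < 1" and y: "0 < y" "y < 1" and st: "stable_pair_law \<alpha> y M"
  shows "moment_series \<alpha> (\<lambda>k. \<integral>x. x ^ k \<partial>ratio_law \<alpha> M) = Abs_fps (\<lambda>k. y ^ k) oo (1 - fps_binomial \<alpha>)"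
proof -
  let ?\<mu> = "ratio_law \<alpha> M"
  define F where "F = moment_series \<alpha> (\<lambda>k. \<integral>x. x ^ k \<partial>?\<mu>)"
  define B where "B = fps_binomial \<alpha>"
  note ul = unit_law_ratio_law[OF assms]
  have F: "(\<lambda>n. fps_nth F n * z ^ n) sums (1 / (y * (1 + z) powr \<alpha> + (1 - y)))" if z: "\<bar>z\<bar> < 1" for z
  proof -
    have A: "y * (1 + z) powr \<alpha> + (1 - y) > 0" using y z by (intro add_nonneg_pos) auto
    have "(\<lambda>x. (1 + z * x) powr (- \<alpha>)) \<in> borel_measurable unit_borel"
      by (intro measurable_restrict_space1) measurable
    hence m: "(\<lambda>x. (1 + z * x) powr (- \<alpha>)) \<in> borel_measurable ?\<mu>"
      using ul unfolding unit_law_def by (metis measurable_cong_sets)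
    have "(\<integral>x. (1 + z * x) powr (- \<alpha>) \<partial>?\<mu>) = enn2real (\<integral>\<^sup>+x. ennreal ((1 + z * x) powr (- \<alpha>)) \<partial>?\<mu>)"
      by (rule integral_eq_nn_integral[OF m]) simp
    also have "\<dots> = 1 / (y * (1 + z) powr \<alpha> + (1 - y))"
      using A unfolding ratio_law_transform_nn[OF assms z] by simp
    finally show ?thesis using moment_series_sums[OF a ul z] unfolding F_def by simp
  qed
  have B: "(\<lambda>n. fps_nth B n * z ^ n) sums (1 + z) powr \<alpha>" if "\<bar>z\<bar> < 1" for z
    using gen_binomial_real[OF that] unfolding B_def by simp
  have rF: "fps_conv_radius F \<ge> 1" using F by (intro fps_conv_radius_ge_1) (auto simp: sums_iff)
  have rB: "fps_conv_radius B \<ge> 1" using B by (intro fps_conv_radius_ge_1) (auto simp: sums_iff)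
  define D where "D = fps_const (1 - y) + fps_const y * B"
  have r1: "fps_conv_radius (fps_const y * B) \<ge> 1" using rB y by (subst fps_conv_radius_cmult_left) auto
  have rD: "fps_conv_radius D \<ge> 1" unfolding D_def
    by (rule order_trans[OF _ fps_conv_radius_add]) (simp add: r1)
  have rFD: "fps_conv_radius (F * D - 1) \<ge> 1"
    by (rule order_trans[OF _ fps_conv_radius_diff], simp, rule order_trans[OF _ fps_conv_radius_mult])
       (simp add: rF rD)
  have "F * D - 1 = 0"
  proof (rule fps_eq_0_if_eval_eq_0[of 1])
    fix z :: real assume z: "\<bar>z\<bar> < 1"
    have l: "ereal (norm z) < R" if "R \<ge> 1" for R
      using z that by (intro less_le_trans[of _ 1 R]) (auto simp: one_ereal_def)
    have eB: "eval_fps B z = (1 + z) powr \<alpha>" using B[OF z] by (simp add: eval_fps_def sums_iff)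
    have eF: "eval_fps F z = 1 / (y * (1 + z) powr \<alpha> + (1 - y))" using F[OF z] by (simp add: eval_fps_def sums_iff)
    have eD: "eval_fps D z = (1 - y) + y * (1 + z) powr \<alpha>"
      unfolding D_def using l[OF rB] l[OF r1] by (simp add: eval_fps_add eval_fps_mult eB)
    have A: "y * (1 + z) powr \<alpha> + (1 - y) > 0" using y z by (intro add_nonneg_pos) auto
    have "fps_conv_radius (F * D) \<ge> 1" by (rule order_trans[OF _ fps_conv_radius_mult]) (simp add: rF rD)
    then have "eval_fps (F * D - 1) z = eval_fps F z * eval_fps D z - 1"
      using l rF rD by (subst eval_fps_diff) (auto simp: eval_fps_mult)
    then show "eval_fps (F * D - 1) z = 0" unfolding eF eD using A by (simp add: add.commute)
  qed (use rFD in \<open>auto simp: one_ereal_def\<close>)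
  hence "F * (1 - fps_const y * (1 - B)) = 1"
    by (simp add: D_def algebra_simps flip: fps_const_sub)
  then show ?thesis unfolding F_def[symmetric] B_def by (intro geometric_compose) simp_all
qed

section \<open>The beta mixture\<close>

text \<open>
  Integrals of continuous functions are limits of linear combinations of moments, and the indicator of
  a half-line is a limit of continuous functions. This is how measurability in \<open>y\<close> is obtained for a family
  of laws that is given separately for each \<open>y\<close>.
\<close>
lemma measurable_unit_law_kernel:
  assumes ul: "\<And>y. y \<in> space N \<Longrightarrow> unit_law (K y)"
    and mom: "\<And>n. (\<lambda>y. \<integral>x. x ^ n \<partial>K y) \<in> borel_measurable N"
  shows "K \<in> N \<rightarrow>\<^sub>M subprob_algebra unit_borel"
proof -
  have C: "(\<lambda>y. \<integral>x. f x \<partial>K y) \<in> borel_measurable N" if f: "f \<in> C01" for f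
  proof -
    obtain p where p: "uniform_limit {0..1} (\<lambda>n. poly (p n)) f sequentially"
      using C01_poly_approx[OF f] .
    show ?thesis
    proof (rule borel_measurable_LIMSEQ_metric)
      fix n
      have "(\<lambda>y. \<Sum>i\<le>degree (p n). coeff (p n) i * (\<integral>x. x ^ i \<partial>K y)) \<in> borel_measurable N"
        using mom by measurable
      moreover have "(\<integral>x. poly (p n) x \<partial>K y) = (\<Sum>i\<le>degree (p n). coeff (p n) i * (\<integral>x. x ^ i \<partial>K y))"
        if "y \<in> space N" for y
        by (rule integral_poly_moments[OF ul[OF that]])
      ultimately show "(\<lambda>y. \<integral>x. poly (p n) x \<partial>K y) \<in> borel_measurable N"
        by (subst measurable_cong) auto
    next
      fix y assume "y \<in> space N"
      then show "(\<lambda>n. \<integral>x. poly (p n) x \<partial>K y) \<longlonglongrightarrow> (\<integral>x. f x \<partial>K y)"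
        by (intro C01_integral_uniform_limit[OF ul C01_poly f p])
    qed
  qed
  have H: "(\<lambda>y. emeasure (K y) ({0..1} \<inter> {..b})) \<in> borel_measurable N" for b
  proof -
    \<comment> \<open>a continuous ramp from \<open>1\<close> at \<open>b\<close> down to \<open>0\<close> at \<open>b + 1/k\<close>\<close>
    define f where "f = (\<lambda>k x. max 0 (min 1 (1 - real k * (x - b))))"
    have fC: "f k \<in> C01" for k unfolding C01_def f_def by (auto intro!: continuous_intros)
    have lim: "(\<lambda>k. f k x) \<longlonglongrightarrow> indicator {..b} x" for x
    proof (cases "x \<le> b")
      case True
      then have "f k x = 1" for k by (simp add: f_def mult_nonneg_nonpos)
      then show ?thesis using True by simp
    next
      case False
      obtain k0 :: nat where "1 / (x - b) < real k0" using reals_Archimedean2 by blast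
      hence k0: "1 < real k0 * (x - b)" using False by (simp add: field_simps)
      have "f k x = 0" if "k \<ge> k0" for k
      proof -
        have "real k0 * (x - b) \<le> real k * (x - b)" using that False by (intro mult_right_mono) auto
        then show ?thesis using k0 by (simp add: f_def)
      qed
      hence "\<forall>\<^sub>F k in sequentially. f k x = 0" by (auto simp: eventually_sequentially)
      then show ?thesis using False by (simp add: tendsto_eventually)
    qed
    have "(\<lambda>y. \<integral>x. indicat_real {..b} x \<partial>K y) \<in> borel_measurable N"
    proof (rule borel_measurable_LIMSEQ_metric[OF C[OF fC]])
      fix y assume y: "y \<in> space N"
      interpret prob_space "K y" using ul[OF y] unfolding unit_law_def by blast
      have m: "indicat_real {..b} \<in> borel_measurable (K y)"
      proof -
        have "indicat_real {..b} \<in> borel_measurable unit_borel" by (intro measurable_restrict_space1) measurable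
        then show ?thesis using ul[OF y] unfolding unit_law_def by (metis measurable_cong_sets)
      qed
      show "(\<lambda>k. \<integral>x. f k x \<partial>K y) \<longlonglongrightarrow> (\<integral>x. indicat_real {..b} x \<partial>K y)"
        by (rule integral_dominated_convergence[where w = "\<lambda>_. 1"])
           (use C01_integrable[OF ul[OF y] fC] lim m in \<open>auto simp: f_def intro: borel_measurable_integrable\<close>)
    qed
    hence "(\<lambda>y. ennreal (\<integral>x. indicat_real {..b} x \<partial>K y)) \<in> borel_measurable N" by measurable
    moreover have "emeasure (K y) ({0..1} \<inter> {..b}) = ennreal (\<integral>x. indicat_real {..b} x \<partial>K y)" if y: "y \<in> space N" for y
    proof -
      interpret prob_space "K y" using ul[OF y] unfolding unit_law_def by blast
      have "(\<integral>x. indicat_real {..b} x \<partial>K y) = measure (K y) ({..b} \<inter> space (K y))" by simp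
      then show ?thesis unfolding unit_law_space[OF ul[OF y]] by (simp add: emeasure_eq_measure Int_commute)
    qed
    ultimately show ?thesis by (subst measurable_cong) auto
  qed
  show ?thesis
  proof (rule measurable_subprob_algebra_generated[where \<Omega> = "{0..1}" and G = "(\<inter>) {0..1} ` range (\<lambda>b::real. {..b})"])
    have "sets (borel :: real measure) = sigma_sets UNIV (range (\<lambda>b. {..b}))"
      by (subst borel_eq_atMost) simp
    then show "sets unit_borel = sigma_sets {0..1} ((\<inter>) {0..1} ` range (\<lambda>b::real. {..b}))"
      unfolding sets_restrict_space using sigma_sets_Int[of "{0..1::real}" UNIV "range (\<lambda>b. {..b})"]
      by (metis atLeastAtMost_borel top_greatest)
    show "Int_stable ((\<inter>) {0..1} ` range (\<lambda>b::real. {..b}))"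
    proof (rule Int_stableI)
      fix A B :: "real set"
      assume "A \<in> (\<inter>) {0..1} ` range (\<lambda>b::real. {..b})" "B \<in> (\<inter>) {0..1} ` range (\<lambda>b::real. {..b})"
      then obtain a b where "A = {0..1} \<inter> {..a}" "B = {0..1} \<inter> {..b}" by blast
      hence "A \<inter> B = {0..1} \<inter> {..min a b}" by auto
      then show "A \<inter> B \<in> (\<inter>) {0..1} ` range (\<lambda>b::real. {..b})" by blast
    qed
    fix y assume y: "y \<in> space N"
    show "subprob_space (K y)" "sets (K y) = sets unit_borel"
      using ul[OF y] unfolding unit_law_def by (auto intro: prob_space_imp_subprob_space)
  next
    show "(\<lambda>y. emeasure (K y) {0..1}) \<in> borel_measurable N"
    proof -
      have "{0..1::real} \<inter> {..1} = {0..1}" by auto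
      then show ?thesis using H[of 1] by simp
    qed
  qed (use H in auto)
qed

text \<open>
  Outside \<open>(0,1)\<close>, a null set for the beta law, the Dirac law at \<open>0\<close> keeps the family a kernel.
\<close>
definition P_kernel :: "real \<Rightarrow> (real \<Rightarrow> (real \<times> real) measure) \<Rightarrow> real \<Rightarrow> real measure" where
  "P_kernel \<alpha> Q y = (if 0 < y \<and> y < 1 then ratio_law \<alpha> (Q y) else return unit_borel 0)"

context
  fixes \<alpha> c1 c2 :: real and Q :: "real \<Rightarrow> (real \<times> real) measure"
  assumes a: "0 < \<alpha>" "\<alpha> < 1" and c: "0 < c1" "0 < c2"
    and Q: "\<And>y. 0 < y \<Longrightarrow> y < 1 \<Longrightarrow> stable_pair_law \<alpha> y (Q y)"
begin

lemma unit_law_P_kernel: "unit_law (P_kernel \<alpha> Q y)"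
proof (cases "0 < y \<and> y < 1")
  case True
  then show ?thesis unfolding P_kernel_def using unit_law_ratio_law[OF a _ _ Q] by auto
next
  case False
  have "prob_space (return unit_borel 0)" by (intro prob_space_return) (simp add: space_restrict_space)
  then show ?thesis using False unfolding P_kernel_def unit_law_def by auto
qed

lemma P_kernel_moment:
  assumes "0 < y" "y < 1"
  shows "((- \<alpha>) gchoose n) * (\<integral>x. x ^ n \<partial>P_kernel \<alpha> Q y) = (\<Sum>i=0..n. y ^ i * fps_nth ((1 - fps_binomial \<alpha>) ^ i) n)"
proof -
  have "fps_nth (moment_series \<alpha> (\<lambda>k. \<integral>x. x ^ k \<partial>ratio_law \<alpha> (Q y))) n = (\<Sum>i=0..n. y ^ i * fps_nth ((1 - fps_binomial \<alpha>) ^ i) n)"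
    unfolding ratio_law_moment_series[OF a assms Q[OF assms]] by (simp add: fps_compose_nth)
  then show ?thesis using assms by (simp add: moment_series_def P_kernel_def)
qed

lemma measurable_P_kernel: "P_kernel \<alpha> Q \<in> beta_distribution c1 c2 \<rightarrow>\<^sub>M subprob_algebra unit_borel"
proof (rule measurable_unit_law_kernel[OF unit_law_P_kernel])
  fix n
  have "(\<integral>x. x ^ n \<partial>P_kernel \<alpha> Q y) = (if 0 < y \<and> y < 1 then (\<Sum>i=0..n. y ^ i * fps_nth ((1 - fps_binomial \<alpha>) ^ i) n) / ((- \<alpha>) gchoose n) else 0 ^ n)" for y
  proof (cases "0 < y \<and> y < 1")
    case True
    then show ?thesis using P_kernel_moment[of y n] gchoose_minus_nonzero[OF a(1), of n] by (simp add: field_simps)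
  next
    case False
    have "(\<lambda>x::real. x ^ n) \<in> borel_measurable unit_borel" by (intro measurable_restrict_space1) measurable
    hence "(\<integral>x. x ^ n \<partial>return unit_borel 0) = (0::real) ^ n"
      by (intro integral_return) (simp_all add: space_restrict_space)
    then show ?thesis using False by (auto simp: P_kernel_def)
  qed
  then show "(\<lambda>y. \<integral>x. x ^ n \<partial>P_kernel \<alpha> Q y) \<in> borel_measurable (beta_distribution c1 c2)"
    by (simp only:) measurable
qed

text \<open>
  The measurability of the kernel makes the set function in the definition of \<open>P_measure\<close> countably
  additive, so that it is the measure actually obtained from \<open>measure_of\<close>.
\<close>
lemma P_measure_eq_bind: "P_measure \<alpha> c1 c2 Q = beta_distribution c1 c2 \<bind> P_kernel \<alpha> Q" (is "_ = ?P")
proof -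
  have ne: "space (beta_distribution c1 c2) \<noteq> {}" by (simp add: space_beta_distribution)
  have sK: "sets (P_kernel \<alpha> Q y) = sets unit_borel" for y using unit_law_P_kernel unfolding unit_law_def by blast
  have sP: "sets ?P = sets unit_borel" by (rule sets_bind[OF sK ne])
  have spP: "space ?P = {0..1}" using sets_eq_imp_space_eq[OF sP] by (simp add: space_restrict_space)
  have G0: "Gamma (\<alpha> + 1) > 0" using a by (intro Gamma_real_pos) simp
  have inner: "(\<integral>\<^sup>+(Y1, Y2). ennreal ((Y1 + Y2) powr (- \<alpha>)) * indicator S (Y1 / (Y1 + Y2)) \<partial>Q y)
      = ennreal (1 / Gamma (\<alpha> + 1)) * emeasure (P_kernel \<alpha> Q y) S"
    if S: "S \<in> sets unit_borel" and y: "0 < y" "y < 1" for S y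
  proof -
    have sets[measurable_cong]: "sets (Q y) = sets (borel \<Otimes>\<^sub>M borel)" by (rule stable_pair_law_sets[OF Q[OF y]])
    have [measurable]: "indicator S \<in> borel_measurable unit_borel" using S by measurable
    have "emeasure (P_kernel \<alpha> Q y) S = (\<integral>\<^sup>+x. indicator S x \<partial>ratio_law \<alpha> (Q y))"
      using S sK[of y] y by (simp add: P_kernel_def)
    also have "\<dots> = (\<integral>\<^sup>+p. ennreal (Gamma (\<alpha> + 1) * (fst p + snd p) powr (- \<alpha>)) * indicator S (clamp_ratio p) \<partial>Q y)"
      by (rule nn_integral_ratio_law[OF Q[OF y]]) measurable
    finally have "ennreal (1 / Gamma (\<alpha> + 1)) * emeasure (P_kernel \<alpha> Q y) S
      = (\<integral>\<^sup>+p. ennreal (1 / Gamma (\<alpha> + 1)) * (ennreal (Gamma (\<alpha> + 1) * (fst p + snd p) powr (- \<alpha>)) * indicator S (clamp_ratio p)) \<partial>Q y)"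
      by (simp add: nn_integral_cmult)
    also have "\<dots> = (\<integral>\<^sup>+p. ennreal ((fst p + snd p) powr (- \<alpha>)) * indicator S (fst p / (fst p + snd p)) \<partial>Q y)"
    proof (intro nn_integral_cong_AE)
      show "AE p in Q y. ennreal (1 / Gamma (\<alpha> + 1)) * (ennreal (Gamma (\<alpha> + 1) * (fst p + snd p) powr (- \<alpha>)) * indicator S (clamp_ratio p))
        = ennreal ((fst p + snd p) powr (- \<alpha>)) * indicator S (fst p / (fst p + snd p))"
        using stable_pair_sum_pos[OF a y Q[OF y]]
      proof eventually_elim
        case (elim p)
        then show ?case using G0 clamp_ratio_eq[of p] by (simp add: mult.assoc[symmetric] ennreal_mult'[symmetric])
      qed
    qed
    finally show ?thesis by (simp add: case_prod_beta')
  qed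
  have "ennreal (Gamma (\<alpha> + 1)) *
        (\<integral>\<^sup>+y. (\<integral>\<^sup>+(Y1, Y2). ennreal ((Y1 + Y2) powr (- \<alpha>)) * indicator S (Y1 / (Y1 + Y2)) \<partial>Q y) \<partial>beta_distribution c1 c2)
      = emeasure ?P S" if S: "S \<in> sets unit_borel" for S
  proof -
    have m: "(\<lambda>y. emeasure (P_kernel \<alpha> Q y) S) \<in> borel_measurable (beta_distribution c1 c2)"
      using measurable_compose[OF measurable_P_kernel measurable_emeasure_subprob_algebra[OF S]] .
    have "(\<integral>\<^sup>+y. (\<integral>\<^sup>+(Y1, Y2). ennreal ((Y1 + Y2) powr (- \<alpha>)) * indicator S (Y1 / (Y1 + Y2)) \<partial>Q y) \<partial>beta_distribution c1 c2)
      = (\<integral>\<^sup>+y. ennreal (1 / Gamma (\<alpha> + 1)) * emeasure (P_kernel \<alpha> Q y) S \<partial>beta_distribution c1 c2)"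
      using AE_beta_distribution[of c1 c2] by (intro nn_integral_cong_AE) (auto simp: inner[OF S])
    also have "\<dots> = ennreal (1 / Gamma (\<alpha> + 1)) * emeasure ?P S"
      unfolding emeasure_bind[OF ne measurable_P_kernel S] by (rule nn_integral_cmult[OF m])
    finally show ?thesis using G0 by (simp add: mult.assoc[symmetric] ennreal_mult'[symmetric])
  qed
  moreover have "sigma_sets {0..1} (sets unit_borel) = sets unit_borel"
    using sets.sigma_sets_eq[of unit_borel] by (simp add: space_restrict_space)
  moreover have "sets unit_borel \<subseteq> Pow {0..1::real}" using sets.sets_into_space[of _ unit_borel] by (auto simp: space_restrict_space)
  ultimately have "P_measure \<alpha> c1 c2 Q = measure_of {0..1} (sets unit_borel) (emeasure ?P)"
    unfolding P_measure_def by (intro measure_of_eq) auto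
  also have "\<dots> = ?P" using measure_of_of_measure[of ?P] unfolding sP spP .
  finally show ?thesis .
qed

lemma unit_law_P_measure: "unit_law (P_measure \<alpha> c1 c2 Q)"
proof -
  interpret prob_space "beta_distribution c1 c2" by (rule prob_space_beta_distribution[OF c])
  have "prob_space (P_measure \<alpha> c1 c2 Q)" unfolding P_measure_eq_bind
    using unit_law_P_kernel by (intro prob_space_bind[OF _ measurable_P_kernel] AE_I2) (auto simp: unit_law_def)
  moreover have "sets (P_measure \<alpha> c1 c2 Q) = sets unit_borel" unfolding P_measure_eq_bind
    by (rule sets_bind) (use unit_law_P_kernel in \<open>auto simp: unit_law_def space_beta_distribution\<close>)
  ultimately show ?thesis by (simp add: unit_law_def)
qed

text \<open>
  Each coefficient for fixed \<open>y\<close> is a polynomial in \<open>y\<close>; integrating replaces the powers of \<open>y\<close> by the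
  moments of the beta law.
\<close>
lemma P_measure_moment_series:
  "moment_series \<alpha> (\<lambda>k. \<integral>x. x ^ k \<partial>P_measure \<alpha> c1 c2 Q) = beta_moment_series c1 c2 oo (1 - fps_binomial \<alpha>)"
proof (rule fps_ext)
  fix n
  interpret prob_space "beta_distribution c1 c2" by (rule prob_space_beta_distribution[OF c])
  have bm: "has_bochner_integral (beta_distribution c1 c2) (\<lambda>y. y ^ i) (pochhammer c1 i / pochhammer (c1 + c2) i)" for i
    using beta_mixed_moment[OF c, of i 0] by simp
  have "(\<integral>x. x ^ n \<partial>P_measure \<alpha> c1 c2 Q) = (\<integral>y. (\<integral>x. x ^ n \<partial>P_kernel \<alpha> Q y) \<partial>beta_distribution c1 c2)"
    unfolding P_measure_eq_bind
  proof (rule integral_bind[OF _ _ measurable_P_kernel, where B = 1 and B' = 1])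
    show "(\<lambda>x::real. x ^ n) \<in> borel_measurable unit_borel" by (intro measurable_restrict_space1) measurable
    show "AE y in beta_distribution c1 c2. emeasure (P_kernel \<alpha> Q y) (space (P_kernel \<alpha> Q y)) \<le> ennreal 1"
      using unit_law_P_kernel by (auto simp: unit_law_def prob_space.emeasure_space_1)
  qed (auto simp: space_restrict_space power_le_one finite_measure_axioms)
  hence "((- \<alpha>) gchoose n) * (\<integral>x. x ^ n \<partial>P_measure \<alpha> c1 c2 Q)
      = (\<integral>y. ((- \<alpha>) gchoose n) * (\<integral>x. x ^ n \<partial>P_kernel \<alpha> Q y) \<partial>beta_distribution c1 c2)" by simp
  also have "\<dots> = (\<integral>y. (\<Sum>i=0..n. y ^ i * fps_nth ((1 - fps_binomial \<alpha>) ^ i) n) \<partial>beta_distribution c1 c2)"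
  proof (rule integral_cong_AE)
    have "(\<lambda>x::real. x ^ n) \<in> borel_measurable unit_borel" by (intro measurable_restrict_space1) measurable
    from measurable_compose[OF measurable_P_kernel integral_measurable_subprob_algebra[OF this]]
    show "(\<lambda>y. ((- \<alpha>) gchoose n) * (\<integral>x. x ^ n \<partial>P_kernel \<alpha> Q y)) \<in> borel_measurable (beta_distribution c1 c2)"
      by measurable
    show "AE y in beta_distribution c1 c2. ((- \<alpha>) gchoose n) * (\<integral>x. x ^ n \<partial>P_kernel \<alpha> Q y)
      = (\<Sum>i=0..n. y ^ i * fps_nth ((1 - fps_binomial \<alpha>) ^ i) n)"
      using AE_beta_distribution by eventually_elim (simp add: P_kernel_moment)
  qed measurable
  also have "\<dots> = (\<Sum>i=0..n. pochhammer c1 i / pochhammer (c1 + c2) i * fps_nth ((1 - fps_binomial \<alpha>) ^ i) n)"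
    by (intro has_bochner_integral_integral_eq has_bochner_integral_sum has_bochner_integral_mult_left bm)
  finally show "fps_nth (moment_series \<alpha> (\<lambda>k. \<integral>x. x ^ k \<partial>P_measure \<alpha> c1 c2 Q)) n = fps_nth (beta_moment_series c1 c2 oo (1 - fps_binomial \<alpha>)) n"
    by (simp add: moment_series_def beta_moment_series_def fps_compose_nth)
qed

end

theorem theorem2p4:
  fixes \<alpha> c1 c2 :: real
    and T :: "real \<Rightarrow> (real \<Rightarrow> real) \<Rightarrow> real \<Rightarrow> real"
    and Q :: "real \<Rightarrow> (real \<times> real) measure"
  assumes "0 < \<alpha>" and "\<alpha> < 1" and "0 < c1" and "0 < c2"
    and "feller_semigroup T"
    and "generator T = graph_closure (A_poly_graph \<alpha> c1 c2)"
    and "\<And>y. 0 < y \<Longrightarrow> y < 1 \<Longrightarrow> stable_pair_law \<alpha> y (Q y)"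
  shows "(\<exists>!\<mu>. stationary_distribution T \<mu>) \<and> stationary_distribution T (P_measure \<alpha> c1 c2 Q)"
proof -
  have ul: "unit_law (P_measure \<alpha> c1 c2 Q)"
    by (rule unit_law_P_measure[OF assms(1-4)]) (rule assms(7))
  have series: "moment_series \<alpha> (\<lambda>k. \<integral>x. x ^ k \<partial>P_measure \<alpha> c1 c2 Q) = beta_moment_series c1 c2 oo (1 - fps_binomial \<alpha>)"
    by (rule P_measure_moment_series[OF assms(1-4)]) (rule assms(7))
  have "stationary_distribution T (P_measure \<alpha> c1 c2 Q)"
    unfolding stationary_iff_moment_ode[OF assms(1,2,5,6) ul] series moment_ode_compose_beta[OF assms(3,4)]
    by simp
  then show ?thesis using stationary_unique[OF assms(1-6)] by blast
qed

end
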